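(* Let $p$ be a prime and let $\mathcal F$ be a saturated fusion system over a finite $p$-group $S$. Every $\mathcal F$-stable finite $S$-set splits uniquely, up to $S$-isomorphism, as a disjoint union of irreducible $\mathcal F$-stable $S$-sets, and there is a one-to-one correspondence between the (isomorphism classes of) irreducible $\mathcal F$-stable $S$-sets and the $\mathcal F$-conjugacy classes of subgroups of $S$. Hence the semiring $A_+(\mathcal F)$ of isomorphism classes of $\mathcal F$-stable finite $S$-sets is additively a free commutative monoid with rank equal to the number of $\mathcal F$-conjugacy classes of subgroups of $S$.
   Context: Fusion systems. A fusion system $\mathcal F$ over a finite $p$-group $S$ is a category whose objects are the subgroups of $S$ and whose morphism sets $\mathcal F(P,Q)$ satisfy: (1) every morphism is an injective group homomorphism $P\to Q$, and composition is composition of homomorphisms; (2) every homomorphism $P\to Q$ of the form $c_s\colon x\mapsto sxs^{-1}$ with $s\in S$, $sPs^{-1}\leq Q$, is in $\mathcal F(P,Q)$; (3) for every $\varphi\in\mathcal F(P,Q)$ the isomorphism $\varphi\colon P\to\varphi(P)$ and its inverse $\varphi^{-1}\colon\varphi(P)\to P$ are morphisms of $\mathcal F$. Write $\operatorname{Aut}_{\mathcal F}(P)=\mathcal F(P,P)$, and let $\operatorname{Aut}_S(P)$ be the group of automorphisms of $P$ induced by conjugation by elements of $N_S(P)$. Subgroups $P,Q\leq S$ are $\mathcal F$-conjugate, $P\sim_{\mathcal F}Q$, if there is an isomorphism $P\to Q$ in $\mathcal F$; $[P]_{\mathcal F}$ denotes the $\mathcal F$-conjugacy class of $P$. $P$ is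 fully normalized (resp. fully centralized) in $\mathcal F$ if $|N_S(P)|\geq|N_S(Q)|$ (resp. $|C_S(P)|\geq|C_S(Q)|$) for all $Q\in[P]_{\mathcal F}$. $\mathcal F$ is saturated if for all $P\leq S$: (i) if $P$ is fully normalized then $P$ is fully centralized and $\operatorname{Aut}_S(P)$ is a Sylow $p$-subgroup of $\operatorname{Aut}_{\mathcal F}(P)$; (ii) every $\varphi\in\mathcal F(P,S)$ with $\varphi(P)$ fully centralized extends to a morphism in $\mathcal F(N_\varphi,S)$, where $N_\varphi=\{x\in N_S(P)\mid\exists y\in S\colon\varphi\circ c_x=c_y\circ\varphi\}$. Stable sets. For a finite $S$-set $X$ and $\varphi\in\mathcal F(P,S)$, let ${}_{P,\varphi}X$ be the set $X$ with the $P$-action $p.x:=\varphi(p)x$. $X$ is $\mathcal F$-stable if ${}_{P,\varphi}X\cong{}_{P,\mathrm{incl}}X$ as $P$-sets for all $P\leq S$ and all $\varphi\in\mathcal F(P,S)$. The isomorphism classes of finite $S$-sets form a semiring $A_+(S)$ under disjoint union and cartesian product, and $A_+(\mathcal F)\subseteq A_+(S)$ is the subsemiring of $\mathcal F$-stable sets. An $\mathcal F$-stable $S$-set is irreducible if it is non-empty and not isomorphic to a disjoint union of two non-empty $\mathcal F$-stable $S$-sets. *)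

theory Defs
  imports
    "HOL-Library.Infinite_Typeclass"
    "HOL-Computational_Algebra.Primes"
    "HOL-Algebra.Group_Action"
    "HOL-Algebra.Ring"
begin

section \<open>Fusion systems\<close>

text \<open>
  A family of morphism sets \<open>F P Q\<close> is indexed by subsets \<open>P\<close>, \<open>Q\<close> of the group, but is only ever
  used at subgroups.  A morphism with source \<open>P\<close> is a HOL function that is \<open>undefined\<close> outside \<open>P\<close>
  (an element of \<open>extensional P\<close>), so that equality of morphisms is equality of HOL functions, and
  composition is the extensional \<open>compose P\<close>.
\<close>

type_synonym 'a homsets = "'a set \<Rightarrow> 'a set \<Rightarrow> ('a \<Rightarrow> 'a) set"

definition conj_hom :: "('a, 'm) monoid_scheme \<Rightarrow> 'a set \<Rightarrow> 'a \<Rightarrow> 'a \<Rightarrow> 'a"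
  where "conj_hom S P s = (\<lambda>x\<in>P. s \<otimes>\<^bsub>S\<^esub> x \<otimes>\<^bsub>S\<^esub> inv\<^bsub>S\<^esub> s)"

locale fusion_system = group S for S (structure) +
  fixes p :: nat and F :: "'a homsets"
  assumes prime_p: "prime p"
    and finite_carrier: "finite (carrier S)"
    and p_group: "\<exists>n. card (carrier S) = p ^ n"
    and morphism_hom: "\<lbrakk>subgroup P S; subgroup Q S; \<phi> \<in> F P Q\<rbrakk>
          \<Longrightarrow> \<phi> \<in> hom (S\<lparr>carrier := P\<rparr>) (S\<lparr>carrier := Q\<rparr>)"
    and morphism_inj: "\<lbrakk>subgroup P S; subgroup Q S; \<phi> \<in> F P Q\<rbrakk> \<Longrightarrow> inj_on \<phi> P"
    and morphism_ext: "\<lbrakk>subgroup P S; subgroup Q S; \<phi> \<in> F P Q\<rbrakk> \<Longrightarrow> \<phi> \<in> extensional P"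
    and morphism_comp: "\<lbrakk>subgroup P S; subgroup Q S; subgroup R S; \<phi> \<in> F P Q; \<psi> \<in> F Q R\<rbrakk>
          \<Longrightarrow> compose P \<psi> \<phi> \<in> F P R"
    and morphism_conj: "\<lbrakk>subgroup P S; subgroup Q S; s \<in> carrier S; conj_hom S P s ` P \<subseteq> Q\<rbrakk>
          \<Longrightarrow> conj_hom S P s \<in> F P Q"
    and morphism_corestrict: "\<lbrakk>subgroup P S; subgroup Q S; \<phi> \<in> F P Q\<rbrakk> \<Longrightarrow> \<phi> \<in> F P (\<phi> ` P)"
    and morphism_inverse: "\<lbrakk>subgroup P S; subgroup Q S; \<phi> \<in> F P Q\<rbrakk>
          \<Longrightarrow> restrict (inv_into P \<phi>) (\<phi> ` P) \<in> F (\<phi> ` P) P"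

definition fusion_conj :: "'a homsets \<Rightarrow> 'a set \<Rightarrow> 'a set \<Rightarrow> bool"
  where "fusion_conj F P Q \<longleftrightarrow> (\<exists>\<phi>\<in>F P Q. \<exists>\<psi>\<in>F Q P.
           compose P \<psi> \<phi> = (\<lambda>x\<in>P. x) \<and> compose Q \<phi> \<psi> = (\<lambda>x\<in>Q. x))"

definition conj_class :: "('a, 'm) monoid_scheme \<Rightarrow> 'a homsets \<Rightarrow> 'a set \<Rightarrow> 'a set set"
  where "conj_class S F P = {Q. subgroup Q S \<and> fusion_conj F P Q}"

definition conj_classes :: "('a, 'm) monoid_scheme \<Rightarrow> 'a homsets \<Rightarrow> 'a set set set"
  where "conj_classes S F = conj_class S F ` {P. subgroup P S}"

definition centralizer :: "('a, 'm) monoid_scheme \<Rightarrow> 'a set \<Rightarrow> 'a set"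
  where "centralizer S P = {x \<in> carrier S. \<forall>u\<in>P. x \<otimes>\<^bsub>S\<^esub> u = u \<otimes>\<^bsub>S\<^esub> x}"

definition fully_normalized :: "('a, 'm) monoid_scheme \<Rightarrow> 'a homsets \<Rightarrow> 'a set \<Rightarrow> bool"
  where "fully_normalized S F P \<longleftrightarrow>
           (\<forall>Q\<in>conj_class S F P. card (normalizer S P) \<ge> card (normalizer S Q))"

definition fully_centralized :: "('a, 'm) monoid_scheme \<Rightarrow> 'a homsets \<Rightarrow> 'a set \<Rightarrow> bool"
  where "fully_centralized S F P \<longleftrightarrow>
           (\<forall>Q\<in>conj_class S F P. card (centralizer S P) \<ge> card (centralizer S Q))"

definition Aut_fusion :: "'a homsets \<Rightarrow> 'a set \<Rightarrow> ('a \<Rightarrow> 'a) monoid"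
  where "Aut_fusion F P = (BijGroup P)\<lparr>carrier := F P P\<rparr>"

definition Aut_conj :: "('a, 'm) monoid_scheme \<Rightarrow> 'a set \<Rightarrow> ('a \<Rightarrow> 'a) set"
  where "Aut_conj S P = conj_hom S P ` normalizer S P"

definition sylow_subgroup :: "nat \<Rightarrow> 'b set \<Rightarrow> ('b, 'm) monoid_scheme \<Rightarrow> bool"
  where "sylow_subgroup p H G \<longleftrightarrow>
           subgroup H G \<and> card H = p ^ multiplicity p (card (carrier G))"

definition extender :: "('a, 'm) monoid_scheme \<Rightarrow> 'a set \<Rightarrow> ('a \<Rightarrow> 'a) \<Rightarrow> 'a set"
  where "extender S P \<phi> = {x \<in> normalizer S P. \<exists>y\<in>carrier S. \<forall>u\<in>P.
           \<phi> (x \<otimes>\<^bsub>S\<^esub> u \<otimes>\<^bsub>S\<^esub> inv\<^bsub>S\<^esub> x) = y \<otimes>\<^bsub>S\<^esub> \<phi> u \<otimes>\<^bsub>S\<^esub> inv\<^bsub>S\<^esub> y}"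

locale saturated_fusion_system = fusion_system +
  assumes sylow_axiom: "\<lbrakk>subgroup P S; fully_normalized S F P\<rbrakk>
          \<Longrightarrow> fully_centralized S F P \<and> sylow_subgroup p (Aut_conj S P) (Aut_fusion F P)"
    and extension_axiom: "\<lbrakk>subgroup P S; \<phi> \<in> F P (carrier S); fully_centralized S F (\<phi> ` P)\<rbrakk>
          \<Longrightarrow> \<exists>\<psi>\<in>F (extender S P \<phi>) (carrier S). \<forall>u\<in>P. \<psi> u = \<phi> u"


section \<open>Finite sets with a group action\<close>

text \<open>
  A \<open>G\<close>-set is a pair of an underlying set and an action in the sense of \<^locale>\<open>group_action\<close>.
\<close>

type_synonym ('a, 'x) gset = "'x set \<times> ('a \<Rightarrow> 'x \<Rightarrow> 'x)"

definition finite_gset :: "('a, 'm) monoid_scheme \<Rightarrow> ('a, 'x) gset \<Rightarrow> bool"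
  where "finite_gset G X \<longleftrightarrow> finite (fst X) \<and> group_action G (fst X) (snd X)"

definition gset_iso :: "('a, 'm) monoid_scheme \<Rightarrow> ('a, 'x) gset \<Rightarrow> ('a, 'y) gset \<Rightarrow> bool"
  where "gset_iso G X Y \<longleftrightarrow> (\<exists>f. bij_betw f (fst X) (fst Y) \<and>
           (\<forall>g\<in>carrier G. \<forall>x\<in>fst X. f (snd X g x) = snd Y g (f x)))"

definition gset_sum :: "('a, 'x) gset \<Rightarrow> ('a, 'y) gset \<Rightarrow> ('a, 'x + 'y) gset"
  where "gset_sum X Y =
           (fst X <+> fst Y, \<lambda>g. \<lambda>z\<in>fst X <+> fst Y. map_sum (snd X g) (snd Y g) z)"

definition gset_prod :: "('a, 'x) gset \<Rightarrow> ('a, 'y) gset \<Rightarrow> ('a, 'x \<times> 'y) gset"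
  where "gset_prod X Y =
           (fst X \<times> fst Y, \<lambda>g. \<lambda>z\<in>fst X \<times> fst Y. map_prod (snd X g) (snd Y g) z)"

definition gset_Sum :: "'i set \<Rightarrow> ('i \<Rightarrow> ('a, 'x) gset) \<Rightarrow> ('a, 'i \<times> 'x) gset"
  where "gset_Sum I Y =
           (SIGMA i:I. fst (Y i), \<lambda>g. \<lambda>(i, x)\<in>(SIGMA i:I. fst (Y i)). (i, snd (Y i) g x))"

definition gset_empty :: "('a, unit) gset"
  where "gset_empty = ({}, \<lambda>g. \<lambda>x\<in>{}. x)"

definition gset_point :: "('a, unit) gset"
  where "gset_point = ({()}, \<lambda>g. \<lambda>x\<in>{()}. x)"

definition gset_pullback :: "('a \<Rightarrow> 'a) \<Rightarrow> ('a, 'x) gset \<Rightarrow> ('a, 'x) gset"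
  where "gset_pullback \<phi> X = (fst X, \<lambda>g. snd X (\<phi> g))"


section \<open>Stable and irreducible sets\<close>

definition stable_gset :: "('a, 'm) monoid_scheme \<Rightarrow> 'a homsets \<Rightarrow> ('a, 'x) gset \<Rightarrow> bool"
  where "stable_gset S F X \<longleftrightarrow> finite_gset S X \<and>
           (\<forall>P \<phi>. subgroup P S \<and> \<phi> \<in> F P (carrier S) \<longrightarrow>
              gset_iso (S\<lparr>carrier := P\<rparr>) (gset_pullback \<phi> X) (gset_pullback (\<lambda>x\<in>P. x) X))"

text \<open>
  Both summands in a decomposition of \<open>X\<close> embed into \<open>X\<close>, so it is no restriction that they are
  taken over the same element type as \<open>X\<close>.
\<close>

definition irreducible_gset :: "('a, 'm) monoid_scheme \<Rightarrow> 'a homsets \<Rightarrow> ('a, 'x) gset \<Rightarrow> bool"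
  where "irreducible_gset S F X \<longleftrightarrow> stable_gset S F X \<and> fst X \<noteq> {} \<and>
           \<not> (\<exists>(Y :: ('a, 'x) gset) (Z :: ('a, 'x) gset).
                stable_gset S F Y \<and> fst Y \<noteq> {} \<and> stable_gset S F Z \<and> fst Z \<noteq> {} \<and>
                gset_iso S X (gset_sum Y Z))"

definition splits_as ::
  "('a, 'm) monoid_scheme \<Rightarrow> 'a homsets \<Rightarrow> ('a, 'x) gset \<Rightarrow> nat \<Rightarrow> (nat \<Rightarrow> ('a, 'x) gset) \<Rightarrow> bool"
  where "splits_as S F X n Y \<longleftrightarrow>
           (\<forall>i<n. irreducible_gset S F (Y i)) \<and> gset_iso S X (gset_Sum {..<n} Y)"


section \<open>The semirings of isomorphism classes\<close>

text \<open>
  \<open>gset_class S X\<close> collects the finite \<open>S\<close>-sets isomorphic to \<open>X\<close> whose elements have type \<open>'x\<close>,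
  where \<open>X\<close> itself may live over another type \<open>'y\<close>.  If \<open>'x\<close> is infinite, every finite \<open>S\<close>-set over
  any type is isomorphic to one over \<open>'x\<close>; the isomorphism classes over \<open>'x\<close> then represent all
  isomorphism classes of finite \<open>S\<close>-sets.  In particular sums and products, which are formed over
  sum and product types, have a class over \<open>'x\<close>.
\<close>

definition gset_class ::
    "('a, 'm) monoid_scheme \<Rightarrow> ('a, 'y) gset \<Rightarrow> ('a, 'x :: infinite) gset set"
  where "gset_class S X = {Z. finite_gset S Z \<and> gset_iso S X Z}"

definition A_plus :: "('a, 'm) monoid_scheme \<Rightarrow> ('a, 'x :: infinite) gset set ring"
  where "A_plus S =
    \<lparr>carrier = gset_class S ` {X :: ('a, 'x) gset. finite_gset S X},
     mult = (\<lambda>A B. \<Union>X\<in>A. \<Union>Y\<in>B. gset_class S (gset_prod X Y)),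
     one = gset_class S gset_point,
     zero = gset_class S gset_empty,
     add = (\<lambda>A B. \<Union>X\<in>A. \<Union>Y\<in>B. gset_class S (gset_sum X Y))\<rparr>"

definition A_plus_stable ::
    "('a, 'm) monoid_scheme \<Rightarrow> 'a homsets \<Rightarrow> ('a, 'x :: infinite) gset set ring"
  where "A_plus_stable S F =
    (A_plus S)\<lparr>carrier := gset_class S ` {X :: ('a, 'x) gset. stable_gset S F X}\<rparr>"

definition irreducible_classes ::
    "('a, 'm) monoid_scheme \<Rightarrow> 'a homsets \<Rightarrow> ('a, 'x :: infinite) gset set set"
  where "irreducible_classes S F = gset_class S ` {X :: ('a, 'x) gset. irreducible_gset S F X}"


section \<open>Free commutative monoids\<close>

text \<open>
  \<open>M\<close> is free on \<open>B\<close> if every element is a (multiplicatively written) combination of elements of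
  \<open>B\<close> with natural number exponents, of finite support, in exactly one way.
\<close>

definition free_comm_monoid :: "('b, 'm) monoid_scheme \<Rightarrow> 'b set \<Rightarrow> bool"
  where "free_comm_monoid M B \<longleftrightarrow> comm_monoid M \<and> B \<subseteq> carrier M \<and>
           (\<forall>x\<in>carrier M. \<exists>!c :: 'b \<Rightarrow> nat.
              finite {b. c b \<noteq> 0} \<and> {b. c b \<noteq> 0} \<subseteq> B \<and>
              x = (\<Otimes>\<^bsub>M\<^esub>b\<in>{b. c b \<noteq> 0}. b [^]\<^bsub>M\<^esub> c b))"

end

theory Submission
  imports Defs
begin

text \<open>
  A finite \<open>S\<close>-set \<open>X\<close> is determined up to isomorphism by its marks \<open>|X\<^sup>Q|\<close>, or equivalently by the numbers
  of points with stabilizer exactly \<open>Q\<close>, and \<open>X\<close> is stable iff its marks are constant on fusion classes.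
  Choose a fully normalized representative \<open>P\<close> in every class and let the coordinate of \<open>X\<close> at the class be
  the number of orbits isomorphic to \<open>S/P\<close>. Working down from the large subgroups, these coordinates
  determine all marks of a stable set. Conversely every family of natural numbers is realized by a stable
  set: at a subgroup \<open>Q\<close> conjugate to \<open>P\<close>, saturation provides a morphism from the normalizer of \<open>Q\<close> that maps
  \<open>Q\<close> onto \<open>P\<close>, which shows that the missing amount \<open>|X\<^sup>P| - |X\<^sup>Q|\<close> is nonnegative and divisible by the index
  of \<open>Q\<close> in its normalizer, so it can be filled up with orbits \<open>S/Q\<close>. Hence the coordinates identify the
  monoid of stable sets with a free one, in which the irreducible sets are the unit vectors.
\<close>


section \<open>Conjugate subgroups\<close>

text \<open>A single orbit S/P is usually not stable, so irreducible sets cannot be written down;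
  they arise by completing S/P with orbits whose stabilizers are no larger. The mark at Q is the
  exact number at Q plus contributions of larger subgroups, so adding orbits with stabilizers of one
  order leaves the marks at all larger subgroups alone. The representative P has to be fully
  normalized for two reasons. First, Sylow's theorem in its automorphism group and the extension
  axiom together yield the morphism out of the normalizer of Q. Second, the order of N(Q)/Q divides
  the order of N(P)/P, so orbits placed at P can be balanced by orbits S/Q. Stability then forces
  the numbers at all other members of the class, and the coordinate at P is the only free one. Apart
  from composition, inversion and transport, isomorphisms are built by hand only once, by matching
  orbits with equal stabilizers; afterwards every isomorphism, and with it every law of the monoid,
  is an equation between natural numbers.\<close>

definition conjugate :: "('a, 'm) monoid_scheme \<Rightarrow> 'a \<Rightarrow> 'a set \<Rightarrow> 'a set"
  where "conjugate G g P = (\<lambda>x. g \<otimes>\<^bsub>G\<^esub> x \<otimes>\<^bsub>G\<^esub> inv\<^bsub>G\<^esub> g) ` P"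

context group
begin

text \<open>\<open>normalizer\<close> is phrased with products of cosets; the image form
  \<open>conjugate\<close> is easier to compose.\<close>

lemma conj_eq_coset: "P \<subseteq> carrier G \<Longrightarrow> g \<in> carrier G \<Longrightarrow> conjugate G g P = g <# P #> inv g"
  unfolding conjugate_def l_coset_def r_coset_def by auto

lemma conjugate_subgroup:
  assumes "subgroup P G" "g \<in> carrier G"
  shows "subgroup (conjugate G g P) G"
  using subgroup_conjugation_is_surj2[OF assms(2,1)] conj_eq_coset subgroup.subset[OF assms(1)] assms(2)
  by simp

lemma conj_mult:
  "\<lbrakk>g \<in> carrier G; h \<in> carrier G; x \<in> carrier G\<rbrakk>
     \<Longrightarrow> (g \<otimes> h) \<otimes> x \<otimes> inv (g \<otimes> h) = g \<otimes> (h \<otimes> x \<otimes> inv h) \<otimes> inv g"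
  by (simp add: inv_mult_group m_assoc)

lemma conjugate_one: "P \<subseteq> carrier G \<Longrightarrow> conjugate G \<one> P = P"
  unfolding conjugate_def by (force simp: image_iff subset_iff)

lemma conjugate_mult:
  "\<lbrakk>P \<subseteq> carrier G; g \<in> carrier G; h \<in> carrier G\<rbrakk>
     \<Longrightarrow> conjugate G (g \<otimes> h) P = conjugate G g (conjugate G h P)"
  unfolding conjugate_def image_image by (rule image_cong) (auto intro: conj_mult)

lemma conjugate_inv:
  "\<lbrakk>P \<subseteq> carrier G; g \<in> carrier G\<rbrakk> \<Longrightarrow> conjugate G (inv g) (conjugate G g P) = P"
  using conjugate_mult[of P "inv g" g] conjugate_one by simp

lemma card_conjugate: "\<lbrakk>P \<subseteq> carrier G; g \<in> carrier G\<rbrakk> \<Longrightarrow> card (conjugate G g P) = card P"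
  unfolding conjugate_def by (rule card_image) (auto simp: inj_on_def subset_iff)

lemma mem_normalizer_iff:
  "P \<subseteq> carrier G \<Longrightarrow> g \<in> normalizer G P \<longleftrightarrow> g \<in> carrier G \<and> conjugate G g P = P"
  unfolding normalizer_def stabilizer_def using conj_eq_coset by auto

text \<open>One inclusion is enough by finiteness, since \<open>conjugate G g P\<close> has as many
  elements as \<open>P\<close>.\<close>

lemma normalizerI:
  assumes P: "subgroup P G" and fin: "finite P" and g: "g \<in> carrier G"
    and sub: "\<And>x. x \<in> P \<Longrightarrow> g \<otimes> x \<otimes> inv g \<in> P"
  shows "g \<in> normalizer G P"
proof -
  have PG: "P \<subseteq> carrier G" using P by (rule subgroup.subset)
  have "conjugate G g P \<subseteq> P" using sub unfolding conjugate_def by auto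
  hence "conjugate G g P = P"
    using card_conjugate[OF PG g] fin by (simp add: card_subset_eq)
  thus ?thesis using mem_normalizer_iff PG g by blast
qed

lemma subset_normalizer:
  assumes P: "subgroup P G" and fin: "finite P"
  shows "P \<subseteq> normalizer G P"
proof
  fix g assume g: "g \<in> P"
  show "g \<in> normalizer G P"
  proof (rule normalizerI[OF P fin])
    show "g \<in> carrier G" using subgroup.mem_carrier[OF P g] .
    show "g \<otimes> x \<otimes> inv g \<in> P" if "x \<in> P" for x
      using subgroup.m_closed[OF P subgroup.m_closed[OF P g that] subgroup.m_inv_closed[OF P g]] .
  qed
qed

end


section \<open>Counting points by their stabilizer\<close>

text \<open>Bijectivity comes from the two laws: \<open>a (inv g)\<close> inverts
  \<open>a g\<close>. Extensionality has to be asked for because \<open>BijGroup\<close> consists of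
  extensional functions.\<close>

lemma (in group) group_actionI:
  assumes ext: "\<And>g. g \<in> carrier G \<Longrightarrow> a g \<in> extensional E"
    and closed: "\<And>g x. \<lbrakk>g \<in> carrier G; x \<in> E\<rbrakk> \<Longrightarrow> a g x \<in> E"
    and one: "\<And>x. x \<in> E \<Longrightarrow> a \<one> x = x"
    and mult: "\<And>g h x. \<lbrakk>g \<in> carrier G; h \<in> carrier G; x \<in> E\<rbrakk> \<Longrightarrow> a (g \<otimes> h) x = a g (a h x)"
  shows "group_action G E a"
proof -
  have bij: "a g \<in> Bij E" if g: "g \<in> carrier G" for g
  proof -
    have "a (inv g) (a g x) = x" "a g (a (inv g) x) = x" if "x \<in> E" for x
      using mult[of "inv g" g x] mult[of g "inv g" x] one g that by auto
    hence "bij_betw (a g) E E"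
      by (intro bij_betwI[where g = "a (inv g)"]) (use closed g in auto)
    thus ?thesis using ext g by (simp add: Bij_def)
  qed
  have "a (g \<otimes> h) = compose E (a g) (a h)" if "g \<in> carrier G" "h \<in> carrier G" for g h
    using mult ext that by (intro extensionalityI[where A = E]) (auto simp: compose_def)
  hence "a \<in> hom G (BijGroup E)"
    using bij by (auto simp: hom_def BijGroup_def)
  thus ?thesis
    by (simp add: group_action_def group_hom_def group_hom_axioms_def group_BijGroup is_group)
qed

section \<open>Group actions: stabilizers, orbits and fixed points of p-groups\<close>

lemma (in group_action) group_G: "group G"
  using group_hom group_hom.axioms(1) by auto

lemma (in group_action) closed: "\<lbrakk>g \<in> carrier G; x \<in> E\<rbrakk> \<Longrightarrow> \<phi> g x \<in> E"
  using element_image by blast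

lemma (in group_action) one_act: "x \<in> E \<Longrightarrow> \<phi> \<one> x = x"
  by (metis id_eq_one restrict_apply')

lemma (in group_action) inv_act: "\<lbrakk>g \<in> carrier G; x \<in> E\<rbrakk> \<Longrightarrow> \<phi> (inv g) (\<phi> g x) = x"
  using orbit_sym_aux by blast

lemma (in group_action) act_inv: "\<lbrakk>g \<in> carrier G; x \<in> E\<rbrakk> \<Longrightarrow> \<phi> g (\<phi> (inv g) x) = x"
  using inv_act[of "inv g" x] group_G by (simp add: group.inv_inv group.inv_closed)

lemma (in group_action) pullback:
  assumes "group H" "h \<in> hom H G"
  shows "group_action H E (\<lambda>x. \<phi> (h x))"
proof -
  have "\<phi> \<circ> h \<in> hom H (BijGroup E)"
    using hom_compose[OF assms(2) group_hom.homh[OF group_hom]] .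
  thus ?thesis
    by (simp add: group_action_def group_hom_def group_hom_axioms_def group_BijGroup assms comp_def)
qed

lemma (in group_action) restrict_subgroup:
  assumes "subgroup H G"
  shows "group_action (G\<lparr>carrier := H\<rparr>) E \<phi>"
  using pullback[of "G\<lparr>carrier := H\<rparr>" "\<lambda>x. x"] group.subgroup_imp_group[OF group_G assms]
    subgroup.subset[OF assms] by (auto simp: hom_def)

text \<open>One inclusion is proved for all \<open>g\<close> and \<open>x\<close>; the other is the
  same inclusion for \<open>inv g\<close> at the point \<open>\<phi> g x\<close>, conjugated
  back.\<close>

lemma (in group_action) stabilizer_act:
  assumes g: "g \<in> carrier G" and x: "x \<in> E"
  shows "stabilizer G \<phi> (\<phi> g x) = conjugate G g (stabilizer G \<phi> x)"
proof -
  interpret group G by (rule group_G)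
  have *: "conjugate G g (stabilizer G \<phi> x) \<subseteq> stabilizer G \<phi> (\<phi> g x)"
    if "g \<in> carrier G" "x \<in> E" for g x
  proof
    fix h assume "h \<in> conjugate G g (stabilizer G \<phi> x)"
    then obtain k where k: "k \<in> carrier G" "\<phi> k x = x" "h = g \<otimes> k \<otimes> inv g"
      by (auto simp: conjugate_def stabilizer_def)
    have "\<phi> h (\<phi> g x) = \<phi> (g \<otimes> k) (\<phi> (inv g) (\<phi> g x))"
      using k that closed by (simp add: composition_rule)
    also have "\<dots> = \<phi> g x" using k that by (simp add: inv_act composition_rule)
    finally show "h \<in> stabilizer G \<phi> (\<phi> g x)" using k that by (simp add: stabilizer_def)
  qed
  have sub: "stabilizer G \<phi> y \<subseteq> carrier G" for y by (rule stabilizer_subset)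
  have "conjugate G (inv g) (stabilizer G \<phi> (\<phi> g x)) \<subseteq> stabilizer G \<phi> x"
    using *[of "inv g" "\<phi> g x"] g x closed by (simp add: inv_act)
  hence "conjugate G g (conjugate G (inv g) (stabilizer G \<phi> (\<phi> g x)))
          \<subseteq> conjugate G g (stabilizer G \<phi> x)"
    unfolding conjugate_def by auto
  moreover have "conjugate G g (conjugate G (inv g) (stabilizer G \<phi> (\<phi> g x))) = stabilizer G \<phi> (\<phi> g x)"
    using conjugate_inv[of _ "inv g"] sub g by simp
  ultimately show ?thesis using *[OF g x] by simp
qed

text \<open>An invariant set is a disjoint union of orbits.\<close>

lemma (in group_action) dvd_card_invariant:
  assumes fin: "finite E" and A: "A \<subseteq> E"
    and inv: "\<And>g x. \<lbrakk>g \<in> carrier G; x \<in> A\<rbrakk> \<Longrightarrow> \<phi> g x \<in> A"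
    and dvd: "\<And>x. x \<in> A \<Longrightarrow> k dvd card (orbit G \<phi> x)"
  shows "k dvd card A"
proof -
  have sub: "orbit G \<phi> x \<subseteq> A" if "x \<in> A" for x using inv that by (auto simp: orbit_def)
  have "A = \<Union> (orbit G \<phi> ` A)"
    using sub A orbit_refl by blast
  moreover have "k dvd card (\<Union> (orbit G \<phi> ` A))"
  proof (rule dvd_partition)
    show "finite (\<Union> (orbit G \<phi> ` A))"
      using finite_subset[OF A fin] sub by (meson UN_least finite_subset)
    show "\<forall>c1\<in>orbit G \<phi> ` A. \<forall>c2\<in>orbit G \<phi> ` A. c1 \<noteq> c2 \<longrightarrow> c1 \<inter> c2 = {}"
    proof (intro ballI impI)
      fix c1 c2 assume "c1 \<in> orbit G \<phi> ` A" "c2 \<in> orbit G \<phi> ` A" "c1 \<noteq> c2"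
      moreover from this have "c1 \<in> orbits G E \<phi>" "c2 \<in> orbits G E \<phi>"
        using A by (auto simp: orbits_def)
      ultimately show "c1 \<inter> c2 = {}" using disjoint_union by blast
    qed
  qed (use dvd in auto)
  ultimately show ?thesis by simp
qed

text \<open>A point that is not fixed has an orbit whose size is a power of p other than 1.\<close>

lemma (in group_action) p_group_fixed_points:
  assumes fin: "finite E" and p: "prime p" and order: "order G = p ^ n"
  shows "p dvd card (E - {x \<in> E. \<forall>g\<in>carrier G. \<phi> g x = x})"
proof (rule dvd_card_invariant[OF fin])
  interpret group G by (rule group_G)
  show "\<phi> g x \<in> E - {x \<in> E. \<forall>g\<in>carrier G. \<phi> g x = x}"
    if g: "g \<in> carrier G" and x: "x \<in> E - {x \<in> E. \<forall>g\<in>carrier G. \<phi> g x = x}" for g x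
  proof -
    \<comment> \<open>Invariance of the complement: if \<open>\<phi> g x\<close> is fixed, then
      acting on it with \<open>inv g\<close> shows that it equals \<open>x\<close>.\<close>
    have fixed: "\<forall>h\<in>carrier G. \<phi> h x = x" if *: "\<forall>h\<in>carrier G. \<phi> h (\<phi> g x) = \<phi> g x"
    proof -
      have "\<phi> (inv g) (\<phi> g x) = \<phi> g x" using * g by blast
      hence "\<phi> g x = x" using inv_act[of g x] g x by auto
      thus ?thesis using * by simp
    qed
    show ?thesis using closed[of g x] g x fixed by blast
  qed
  show "p dvd card (orbit G \<phi> x)" if x: "x \<in> E - {x \<in> E. \<forall>g\<in>carrier G. \<phi> g x = x}" for x
  proof -
    have "x \<in> E" using x by simp
    hence "card (orbit G \<phi> x) * card (stabilizer G \<phi> x) = p ^ n"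
      unfolding order[symmetric] by (rule orbit_stabilizer_theorem)
    hence "card (orbit G \<phi> x) dvd p ^ n" by (rule dvdI[OF sym])
    then obtain k where k: "card (orbit G \<phi> x) = p ^ k"
      using divides_primepow_nat[OF p] by blast
    have "k \<noteq> 0"
    proof
      assume "k = 0"
      then obtain y where y: "orbit G \<phi> x = {y}" using k by (auto simp: card_1_singleton_iff)
      have "y = x" using orbit_refl[OF \<open>x \<in> E\<close>] unfolding y by simp
      have "\<phi> g x = x" if "g \<in> carrier G" for g
        using y \<open>y = x\<close> that unfolding orbit_def by blast
      thus False using x by simp
    qed
    thus ?thesis using k by simp
  qed
qed auto

text \<open>Normality of \<open>P\<close> makes the set of these points invariant, and by
  orbit-stabilizer each of its orbits has |G|/|P| points. With a normalizer in the role of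
  \<open>G\<close> this becomes divisibility by \<open>weyl_order\<close>.\<close>

lemma (in group_action) index_dvd_card_stabilizer_eq:
  assumes finG: "finite (carrier G)" and fin: "finite E" and P: "subgroup P G"
    and normal: "normalizer G P = carrier G"
  shows "(order G div card P) dvd card {x \<in> E. stabilizer G \<phi> x = P}"
proof (rule dvd_card_invariant[OF fin])
  interpret group G by (rule group_G)
  have PG: "P \<subseteq> carrier G" using P by (rule subgroup.subset)
  show "\<phi> g x \<in> {x \<in> E. stabilizer G \<phi> x = P}"
    if "g \<in> carrier G" "x \<in> {x \<in> E. stabilizer G \<phi> x = P}" for g x
  proof -
    have "conjugate G g P = P" using that(1) normal mem_normalizer_iff[OF PG, of g] by simp
    thus ?thesis using that stabilizer_act[of g x] closed[of g x] by simp
  qed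
  show "order G div card P dvd card (orbit G \<phi> x)" if x: "x \<in> {x \<in> E. stabilizer G \<phi> x = P}" for x
  proof -
    have "finite P" using finite_subset[OF PG finG] .
    moreover have "P \<noteq> {}" using subgroup.one_closed[OF P] by auto
    ultimately have "card P > 0" by (simp add: card_gt_0_iff)
    moreover have "card (orbit G \<phi> x) * card P = order G"
      using orbit_stabilizer_theorem[of x] x by auto
    ultimately have "order G div card P = card (orbit G \<phi> x)"
      by (metis nonzero_mult_div_cancel_right less_numeral_extra(3))
    thus ?thesis by simp
  qed
qed auto

section \<open>Exact stabilizer counts and marks\<close>

definition exact :: "('a, 'm) monoid_scheme \<Rightarrow> ('a, 'x) gset \<Rightarrow> 'a set \<Rightarrow> nat"
  where "exact G X R = card {x \<in> fst X. stabilizer G (snd X) x = R}"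

text \<open>Fixed points are expressed through stabilizers, so that \<open>mark\<close> and
  \<open>exact\<close> both count the points whose stabilizer satisfies a predicate
  \<open>T\<close>. One lemma about such counts then serves both.\<close>

definition mark :: "('a, 'm) monoid_scheme \<Rightarrow> ('a, 'x) gset \<Rightarrow> 'a set \<Rightarrow> nat"
  where "mark G X Q = card {x \<in> fst X. Q \<subseteq> stabilizer G (snd X) x}"

lemma finite_subgroups: "finite (carrier G) \<Longrightarrow> finite {R. subgroup R G \<and> T R}"
  by (rule finite_subset[of _ "Pow (carrier G)"]) (auto dest: subgroup.subset)

lemma mark_eq_sum:
  assumes G: "finite (carrier G)" and X: "finite_gset G X"
  shows "mark G X Q = (\<Sum>R | subgroup R G \<and> Q \<subseteq> R. exact G X R)"
proof -
  let ?I = "{R. subgroup R G \<and> Q \<subseteq> R}"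
  have sub: "subgroup (stabilizer G (snd X) x) G" if "x \<in> fst X" for x
    using X group_action.stabilizer_subgroup that unfolding finite_gset_def by fast
  have "{x \<in> fst X. Q \<subseteq> stabilizer G (snd X) x}
          = (\<Union>R\<in>?I. {x \<in> fst X. stabilizer G (snd X) x = R})"
    using sub by blast
  moreover have "card (\<Union>R\<in>?I. {x \<in> fst X. stabilizer G (snd X) x = R})
          = (\<Sum>R\<in>?I. card {x \<in> fst X. stabilizer G (snd X) x = R})"
    using X by (intro card_UN_disjoint finite_subgroups[OF G]) (auto simp: finite_gset_def)
  ultimately show ?thesis unfolding mark_def exact_def by simp
qed

text \<open>The triangularity behind all downward inductions: once the exact numbers strictly above
  \<open>Q\<close> are known, the mark and the exact number at \<open>Q\<close> determine each
  other.\<close>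

lemma mark_split:
  assumes G: "finite (carrier G)" and X: "finite_gset G X" and Q: "subgroup Q G"
  shows "mark G X Q = exact G X Q + (\<Sum>R | subgroup R G \<and> Q \<subset> R. exact G X R)"
proof -
  have *: "{R. subgroup R G \<and> Q \<subseteq> R} = insert Q {R. subgroup R G \<and> Q \<subset> R}" using Q by auto
  show ?thesis
    unfolding mark_eq_sum[OF G X] * by (subst sum.insert) (auto intro: finite_subgroups[OF G])
qed

text \<open>Moebius inversion in the guise of an induction from large to small subgroups. The marks
  are compared only from \<open>Q\<close> upwards, which is all that is known when this is applied
  inside a normalizer.\<close>

lemma exact_eq_if_mark_eq:
  assumes G: "finite (carrier G)" and X: "finite_gset G X" and Y: "finite_gset G Y"
    and Q: "subgroup Q G"
    and eq: "\<And>R. \<lbrakk>subgroup R G; Q \<subseteq> R\<rbrakk> \<Longrightarrow> mark G X R = mark G Y R"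
  shows "exact G X Q = exact G Y Q"
  using Q eq
proof (induction "card (carrier G) - card Q" arbitrary: Q rule: less_induct)
  case less
  have "exact G X R = exact G Y R" if R: "subgroup R G" "Q \<subset> R" for R
  proof (rule less.hyps)
    have "R \<subseteq> carrier G" using R(1) by (rule subgroup.subset)
    hence "card R \<le> card (carrier G)" "card Q < card R"
      using R(2) G by (meson card_mono, meson psubset_card_mono finite_subset)
    thus "card (carrier G) - card R < card (carrier G) - card Q" by simp
    show "mark G X T = mark G Y T" if "subgroup T G" "R \<subseteq> T" for T
      using less.prems(2)[of T] that R by auto
  qed fact
  hence "(\<Sum>R | subgroup R G \<and> Q \<subset> R. exact G X R) = (\<Sum>R | subgroup R G \<and> Q \<subset> R. exact G Y R)"
    by (intro sum.cong) auto
  thus ?case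
    using less.prems mark_split[OF G X, of Q] mark_split[OF G Y, of Q] by simp
qed


section \<open>Isomorphisms of finite sets with action\<close>

lemma finite_gsetD: "finite_gset G X \<Longrightarrow> finite (fst X)" "finite_gset G X \<Longrightarrow> group_action G (fst X) (snd X)"
  by (auto simp: finite_gset_def)

lemma stabilizer_equivariant:
  assumes inj: "inj_on f A" and x: "x \<in> A" and inv: "\<And>g. g \<in> carrier G \<Longrightarrow> \<phi> g x \<in> A"
    and equiv: "\<And>g. g \<in> carrier G \<Longrightarrow> f (\<phi> g x) = \<psi> g (f x)"
  shows "stabilizer G \<psi> (f x) = stabilizer G \<phi> x"
  unfolding stabilizer_def using inj_on_eq_iff[OF inj inv x] equiv by metis

lemma card_stabilizer_equivariant:
  assumes bij: "bij_betw f A B" and inv: "\<And>g x. \<lbrakk>g \<in> carrier G; x \<in> A\<rbrakk> \<Longrightarrow> \<phi> g x \<in> A"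
    and equiv: "\<And>g x. \<lbrakk>g \<in> carrier G; x \<in> A\<rbrakk> \<Longrightarrow> f (\<phi> g x) = \<psi> g (f x)"
  shows "card {x \<in> A. T (stabilizer G \<phi> x)} = card {y \<in> B. T (stabilizer G \<psi> y)}"
proof (rule bij_betw_same_card)
  have *: "stabilizer G \<psi> (f x) = stabilizer G \<phi> x" if "x \<in> A" for x
    using bij inv equiv that by (intro stabilizer_equivariant[where A = A]) (auto simp: bij_betw_def)
  have "f ` {x \<in> A. T (stabilizer G \<phi> x)} = {y \<in> B. T (stabilizer G \<psi> y)}"
    using bij * unfolding bij_betw_def by force
  moreover have "inj_on f {x \<in> A. T (stabilizer G \<phi> x)}"
    using bij unfolding bij_betw_def by (auto intro: inj_on_subset)
  ultimately show "bij_betw f {x \<in> A. T (stabilizer G \<phi> x)} {y \<in> B. T (stabilizer G \<psi> y)}"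
    unfolding bij_betw_def by simp
qed

section \<open>Finite sets with action up to isomorphism, and their classification by marks\<close>

lemma gset_iso_refl: "gset_iso G X X"
  unfolding gset_iso_def by (rule exI[of _ id]) auto

text \<open>\<open>gset_iso\<close> by itself does not say that the carriers are closed under the
  operation; that \<open>X\<close> is an action is what makes the inverse map equivariant.\<close>

lemma gset_iso_sym:
  assumes "finite_gset G X" "gset_iso G X Y"
  shows "gset_iso G Y X"
proof -
  interpret group_action G "fst X" "snd X" using assms(1) by (rule finite_gsetD)
  obtain f where f: "bij_betw f (fst X) (fst Y)"
    "\<And>g x. \<lbrakk>g \<in> carrier G; x \<in> fst X\<rbrakk> \<Longrightarrow> f (snd X g x) = snd Y g (f x)"
    using assms(2) by (auto simp: gset_iso_def)
  let ?h = "inv_into (fst X) f"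
  have h: "bij_betw ?h (fst Y) (fst X)" using f(1) by (rule bij_betw_inv_into)
  have "?h (snd Y g y) = snd X g (?h y)" if g: "g \<in> carrier G" and y: "y \<in> fst Y" for g y
  proof -
    have x: "?h y \<in> fst X" using h y by (auto simp: bij_betw_def)
    have "f (?h y) = y" using f(1) y by (rule bij_betw_inv_into_right)
    hence "snd Y g y = f (snd X g (?h y))" using f(2)[OF g x] by simp
    thus ?thesis using bij_betw_inv_into_left[OF f(1)] closed[OF g x] by simp
  qed
  thus ?thesis using h unfolding gset_iso_def by blast
qed

lemma gset_iso_trans:
  assumes "gset_iso G X Y" "gset_iso G Y Z"
  shows "gset_iso G X Z"
proof -
  obtain f where f: "bij_betw f (fst X) (fst Y)"
    "\<forall>g\<in>carrier G. \<forall>x\<in>fst X. f (snd X g x) = snd Y g (f x)"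
    using assms(1) by (auto simp: gset_iso_def)
  obtain h where h: "bij_betw h (fst Y) (fst Z)"
    "\<forall>g\<in>carrier G. \<forall>x\<in>fst Y. h (snd Y g x) = snd Z g (h x)"
    using assms(2) by (auto simp: gset_iso_def)
  have "bij_betw (h \<circ> f) (fst X) (fst Z)" using f(1) h(1) by (rule bij_betw_trans)
  moreover have "\<forall>g\<in>carrier G. \<forall>x\<in>fst X. (h \<circ> f) (snd X g x) = snd Z g ((h \<circ> f) x)"
    using f h bij_betwE[OF f(1)] by simp
  ultimately show ?thesis unfolding gset_iso_def by blast
qed

lemma card_stabilizer_iso:
  assumes "finite_gset G X" "gset_iso G X Y"
  shows "card {x \<in> fst X. T (stabilizer G (snd X) x)} = card {y \<in> fst Y. T (stabilizer G (snd Y) y)}"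
proof -
  interpret group_action G "fst X" "snd X" using assms(1) by (rule finite_gsetD)
  obtain f where "bij_betw f (fst X) (fst Y)"
    "\<And>g x. \<lbrakk>g \<in> carrier G; x \<in> fst X\<rbrakk> \<Longrightarrow> f (snd X g x) = snd Y g (f x)"
    using assms(2) by (auto simp: gset_iso_def)
  thus ?thesis by (intro card_stabilizer_equivariant) (use closed in auto)
qed

lemma exact_iso: "\<lbrakk>finite_gset G X; gset_iso G X Y\<rbrakk> \<Longrightarrow> exact G X R = exact G Y R"
  unfolding exact_def by (rule card_stabilizer_iso)

lemma mark_iso: "\<lbrakk>finite_gset G X; gset_iso G X Y\<rbrakk> \<Longrightarrow> mark G X R = mark G Y R"
  unfolding mark_def by (rule card_stabilizer_iso)

text \<open>Both orbits are the coset space of the common stabilizer: \<open>g\<close> and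
  \<open>h\<close> move \<open>x\<close> to the same point iff \<open>inv h \<otimes> g\<close> lies
  in the stabilizer, and likewise for \<open>y\<close>.\<close>

lemma orbit_equivariant_bij:
  assumes E: "group_action G E \<phi>" and D: "group_action G D \<psi>"
    and x: "x \<in> E" and y: "y \<in> D" and stab: "stabilizer G \<phi> x = stabilizer G \<psi> y"
  obtains f where "bij_betw f (orbit G \<phi> x) (orbit G \<psi> y)"
    "\<And>g z. \<lbrakk>g \<in> carrier G; z \<in> orbit G \<phi> x\<rbrakk> \<Longrightarrow> f (\<phi> g z) = \<psi> g (f z)"
proof -
  interpret E: group_action G E \<phi> by fact
  interpret D: group_action G D \<psi> by fact
  interpret group G by (rule E.group_G)
  have eq_iff: "\<phi> g x = \<phi> h x \<longleftrightarrow> inv\<^bsub>G\<^esub> h \<otimes>\<^bsub>G\<^esub> g \<in> stabilizer G \<phi> x" if "g \<in> carrier G" "h \<in> carrier G" for g h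
  proof -
    have "\<phi> (inv\<^bsub>G\<^esub> h \<otimes>\<^bsub>G\<^esub> g) x = \<phi> (inv\<^bsub>G\<^esub> h) (\<phi> g x)" using that x by (simp add: E.composition_rule)
    moreover have "\<phi> (inv\<^bsub>G\<^esub> h) (\<phi> g x) = x \<longleftrightarrow> \<phi> g x = \<phi> h x"
      using that x E.act_inv[of h "\<phi> g x"] E.inv_act[of h x] E.closed[of g x] by metis
    ultimately show ?thesis using that by (simp add: stabilizer_def)
  qed
  have eq_iff': "\<psi> g y = \<psi> h y \<longleftrightarrow> inv\<^bsub>G\<^esub> h \<otimes>\<^bsub>G\<^esub> g \<in> stabilizer G \<psi> y" if "g \<in> carrier G" "h \<in> carrier G" for g h
  proof -
    have "\<psi> (inv\<^bsub>G\<^esub> h \<otimes>\<^bsub>G\<^esub> g) y = \<psi> (inv\<^bsub>G\<^esub> h) (\<psi> g y)" using that y by (simp add: D.composition_rule)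
    moreover have "\<psi> (inv\<^bsub>G\<^esub> h) (\<psi> g y) = y \<longleftrightarrow> \<psi> g y = \<psi> h y"
      using that y D.act_inv[of h "\<psi> g y"] D.inv_act[of h y] D.closed[of g y] by metis
    ultimately show ?thesis using that by (simp add: stabilizer_def)
  qed
  have same: "\<phi> g x = \<phi> h x \<longleftrightarrow> \<psi> g y = \<psi> h y" if "g \<in> carrier G" "h \<in> carrier G" for g h
    using eq_iff[OF that] eq_iff'[OF that] stab by simp
  \<comment> \<open>Any group element leading from \<open>x\<close> to \<open>z\<close> may be
    chosen; by \<open>same\<close> the value does not depend on it.\<close>
  define f where "f z = \<psi> (SOME g. g \<in> carrier G \<and> \<phi> g x = z) y" for z
  have f: "f (\<phi> g x) = \<psi> g y" if g: "g \<in> carrier G" for g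
  proof -
    let ?h = "SOME h. h \<in> carrier G \<and> \<phi> h x = \<phi> g x"
    have "?h \<in> carrier G \<and> \<phi> ?h x = \<phi> g x" by (rule someI[of _ g]) (use g in simp)
    thus ?thesis unfolding f_def using same[of ?h g] g by simp
  qed
  have "f ` orbit G \<phi> x = orbit G \<psi> y"
    unfolding orbit_def using f by force
  moreover have "inj_on f (orbit G \<phi> x)"
    unfolding orbit_def using f same by (auto simp: inj_on_def)
  ultimately have bij: "bij_betw f (orbit G \<phi> x) (orbit G \<psi> y)" by (simp add: bij_betw_def)
  have equiv: "f (\<phi> g z) = \<psi> g (f z)" if g: "g \<in> carrier G" and z: "z \<in> orbit G \<phi> x" for g z
  proof -
    obtain h where h: "h \<in> carrier G" "z = \<phi> h x" using z by (auto simp: orbit_def)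
    have "\<phi> g z = \<phi> (g \<otimes>\<^bsub>G\<^esub> h) x" using g h x by (simp add: E.composition_rule)
    hence "f (\<phi> g z) = \<psi> (g \<otimes>\<^bsub>G\<^esub> h) y" using f g h by simp
    thus ?thesis using f[OF h(1)] g h y by (simp add: D.composition_rule)
  qed
  show thesis by (rule that[OF bij equiv])
qed

text \<open>Equal counts give \<open>B\<close> a point with the stabilizer of a chosen
  \<open>x\<close> in \<open>A\<close>; their orbits are matched and removed. The statement is about
  invariant subsets of fixed actions, so that removing an orbit does not require a new action on the
  rest.\<close>

lemma equivariant_bij_if_card_eq:
  assumes E: "group_action G E \<phi>" and D: "group_action G D \<psi>"
    and "finite A" "A \<subseteq> E" "finite B" "B \<subseteq> D"
    and "\<And>g x. \<lbrakk>g \<in> carrier G; x \<in> A\<rbrakk> \<Longrightarrow> \<phi> g x \<in> A"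
    and "\<And>g x. \<lbrakk>g \<in> carrier G; x \<in> B\<rbrakk> \<Longrightarrow> \<psi> g x \<in> B"
    and "\<And>R. card {x \<in> A. stabilizer G \<phi> x = R} = card {y \<in> B. stabilizer G \<psi> y = R}"
  shows "\<exists>f. bij_betw f A B \<and> (\<forall>g\<in>carrier G. \<forall>x\<in>A. f (\<phi> g x) = \<psi> g (f x))"
  using assms(3-)
proof (induction "card A" arbitrary: A B rule: less_induct)
  case less
  interpret E: group_action G E \<phi> by fact
  interpret D: group_action G D \<psi> by fact
  note fin = \<open>finite A\<close> \<open>finite B\<close>
  note invA = less.prems(5) and invB = less.prems(6) and card_eq = less.prems(7)
  show ?case
  proof (cases "A = {}")
    case True
    have "B = {}"
    proof (rule ccontr)
      assume "B \<noteq> {}"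
      then obtain y where "y \<in> B" by auto
      hence "card {z \<in> B. stabilizer G \<psi> z = stabilizer G \<psi> y} \<noteq> 0" using fin by auto
      thus False using card_eq[of "stabilizer G \<psi> y"] True by simp
    qed
    thus ?thesis using True by (simp add: bij_betw_def)
  next
    case False
    then obtain x where x: "x \<in> A" by auto
    hence "card {z \<in> A. stabilizer G \<phi> z = stabilizer G \<phi> x} \<noteq> 0" using fin by auto
    hence "{z \<in> B. stabilizer G \<psi> z = stabilizer G \<phi> x} \<noteq> {}"
      using card_eq[of "stabilizer G \<phi> x"] by (metis card.empty)
    then obtain y where y: "y \<in> B" "stabilizer G \<psi> y = stabilizer G \<phi> x" by auto
    have xE: "x \<in> E" and yD: "y \<in> D" using x y less.prems by auto
    let ?P = "orbit G \<phi> x" and ?Q = "orbit G \<psi> y"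
    have P: "?P \<subseteq> A" and Q: "?Q \<subseteq> B" using invA invB x y(1) by (auto simp: orbit_def)
    have invP: "\<phi> g z \<in> ?P \<longleftrightarrow> z \<in> ?P" if "g \<in> carrier G" "z \<in> E" for g z
    proof -
      have "\<phi> g z \<in> orbit G \<phi> z" using that by (auto simp: orbit_def)
      thus ?thesis
        using E.orbit_trans[OF xE that(2) E.closed[OF that]] E.orbit_sym[OF that(2) E.closed[OF that]]
          E.orbit_trans[OF xE E.closed[OF that] that(2)] by blast
    qed
    have invQ: "\<psi> g z \<in> ?Q \<longleftrightarrow> z \<in> ?Q" if "g \<in> carrier G" "z \<in> D" for g z
    proof -
      have "\<psi> g z \<in> orbit G \<psi> z" using that by (auto simp: orbit_def)
      thus ?thesis
        using D.orbit_trans[OF yD that(2) D.closed[OF that]] D.orbit_sym[OF that(2) D.closed[OF that]]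
          D.orbit_trans[OF yD D.closed[OF that] that(2)] by blast
    qed
    obtain f where f: "bij_betw f ?P ?Q" "\<And>g z. \<lbrakk>g \<in> carrier G; z \<in> ?P\<rbrakk> \<Longrightarrow> f (\<phi> g z) = \<psi> g (f z)"
      by (rule orbit_equivariant_bij[OF E D xE yD y(2)[symmetric]]) blast
    have cardPQ: "card {z \<in> ?P. stabilizer G \<phi> z = R} = card {z \<in> ?Q. stabilizer G \<psi> z = R}" for R
    proof (rule card_stabilizer_equivariant[OF f(1)])
      show "\<phi> g z \<in> ?P" if "g \<in> carrier G" "z \<in> ?P" for g z
        using that invP P less.prems(2) by blast
    qed (rule f(2))
    have split: "card {z \<in> C - M. T z} = card {z \<in> C. T z} - card {z \<in> M. T z}"
      if "finite C" "M \<subseteq> C" for C M and T :: "'z \<Rightarrow> bool"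
    proof -
      have "{z \<in> C - M. T z} = {z \<in> C. T z} - {z \<in> M. T z}" by auto
      moreover have "{z \<in> M. T z} \<subseteq> {z \<in> C. T z}" "finite {z \<in> M. T z}"
        using that by (auto intro: finite_subset)
      ultimately show ?thesis by (simp add: card_Diff_subset)
    qed
    have "\<exists>h. bij_betw h (A - ?P) (B - ?Q) \<and> (\<forall>g\<in>carrier G. \<forall>z\<in>A - ?P. h (\<phi> g z) = \<psi> g (h z))"
    proof (rule less.hyps)
      have "A - ?P \<subset> A" using x E.orbit_refl[OF xE] by auto
      thus "card (A - ?P) < card A" using fin by (simp add: psubset_card_mono)
      show "\<phi> g z \<in> A - ?P" if "g \<in> carrier G" "z \<in> A - ?P" for g z
        using that invA[of g z] invP[of g z] less.prems(2) by blast
      show "\<psi> g z \<in> B - ?Q" if "g \<in> carrier G" "z \<in> B - ?Q" for g z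
        using that invB[of g z] invQ[of g z] less.prems(4) by blast
      show "card {z \<in> A - ?P. stabilizer G \<phi> z = R} = card {z \<in> B - ?Q. stabilizer G \<psi> z = R}" for R
        unfolding split[OF fin(1) P] split[OF fin(2) Q] using card_eq cardPQ by simp
    qed (use less.prems in auto)
    then obtain h where h: "bij_betw h (A - ?P) (B - ?Q)"
      "\<And>g z. \<lbrakk>g \<in> carrier G; z \<in> A - ?P\<rbrakk> \<Longrightarrow> h (\<phi> g z) = \<psi> g (h z)" by blast
    let ?k = "\<lambda>z. if z \<in> ?P then f z else h z"
    have "bij_betw ?k (?P \<union> (A - ?P)) (?Q \<union> (B - ?Q))"
    proof (rule bij_betw_combine)
      show "bij_betw ?k ?P ?Q" using f(1) by (simp cong: bij_betw_cong)
      have "bij_betw ?k (A - ?P) (B - ?Q) \<longleftrightarrow> bij_betw h (A - ?P) (B - ?Q)"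
        by (rule bij_betw_cong) auto
      thus "bij_betw ?k (A - ?P) (B - ?Q)" using h(1) by simp
    qed auto
    moreover have "?P \<union> (A - ?P) = A" "?Q \<union> (B - ?Q) = B" using P Q by auto
    ultimately have "bij_betw ?k A B" by simp
    moreover have "?k (\<phi> g z) = \<psi> g (?k z)" if "g \<in> carrier G" "z \<in> A" for g z
      using that f(2)[of g z] h(2)[of g z] invP[of g z] less.prems(2) by auto
    ultimately show ?thesis by blast
  qed
qed

lemma gset_iso_if_exact_eq:
  assumes X: "finite_gset G X" and Y: "finite_gset G Y"
    and eq: "\<And>R. subgroup R G \<Longrightarrow> exact G X R = exact G Y R"
  shows "gset_iso G X Y"
  unfolding gset_iso_def
proof (rule equivariant_bij_if_card_eq)
  show "group_action G (fst X) (snd X)" "group_action G (fst Y) (snd Y)"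
    "finite (fst X)" "finite (fst Y)" using X Y by (auto simp: finite_gset_def)
  then interpret X: group_action G "fst X" "snd X" + Y: group_action G "fst Y" "snd Y" by auto
  show "snd X g x \<in> fst X" if "g \<in> carrier G" "x \<in> fst X" for g x using X.closed that .
  show "snd Y g x \<in> fst Y" if "g \<in> carrier G" "x \<in> fst Y" for g x using Y.closed that .
  show "card {x \<in> fst X. stabilizer G (snd X) x = R} = card {y \<in> fst Y. stabilizer G (snd Y) y = R}" for R
  proof (cases "subgroup R G")
    case True
    thus ?thesis using eq unfolding exact_def by blast
  next
    \<comment> \<open>Stabilizers are subgroups, so at any other set both counts vanish.\<close>
    case False
    hence "{x \<in> fst X. stabilizer G (snd X) x = R} = {}" "{y \<in> fst Y. stabilizer G (snd Y) y = R} = {}"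
      using X.stabilizer_subgroup Y.stabilizer_subgroup by blast+
    thus ?thesis by (simp only: card.empty)
  qed
qed auto

text \<open>Burnside's theorem on marks.\<close>

lemma gset_iso_if_mark_eq:
  assumes "finite (carrier G)" "finite_gset G X" "finite_gset G Y"
    and "\<And>R. subgroup R G \<Longrightarrow> mark G X R = mark G Y R"
  shows "gset_iso G X Y"
  using assms by (intro gset_iso_if_exact_eq exact_eq_if_mark_eq)

text \<open>An infinite type has a subset of every finite size, and the action is carried over along
  a bijection. This brings sums and coset spaces, which live over other types, back to
  \<open>'x\<close>.\<close>

lemma gset_transport:
  fixes X :: "('a, 'y) gset"
  assumes X: "finite_gset G X"
  obtains Z :: "('a, 'x :: infinite) gset" where "finite_gset G Z" "gset_iso G X Z"
proof -
  interpret group_action G "fst X" "snd X" using X by (rule finite_gsetD)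
  interpret group G by (rule group_G)
  have "finite (fst X)" using X by (rule finite_gsetD)
  obtain B :: "'x set" where "finite B" "card B = card (fst X)"
    using infinite_arbitrarily_large[OF infinite_UNIV, of "card (fst X)"] by blast
  then obtain f where f: "bij_betw f (fst X) B"
    using \<open>finite (fst X)\<close> finite_same_card_bij by metis
  let ?i = "inv_into (fst X) f"
  define Z where "Z = (B, \<lambda>g. \<lambda>z\<in>B. f (snd X g (?i z)))"
  have i: "?i z \<in> fst X" "f (?i z) = z" if "z \<in> B" for z
    using f that by (auto simp: bij_betw_def f_inv_into_f inv_into_into)
  have fi: "f x \<in> B" "?i (f x) = x" if "x \<in> fst X" for x
    using f that by (auto simp: bij_betw_def)
  have "group_action G (fst Z) (snd Z)"
    unfolding Z_def fst_conv snd_conv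
  proof (rule group_actionI)
    show "(\<lambda>z\<in>B. f (snd X g (?i z))) x \<in> B" if "g \<in> carrier G" "x \<in> B" for g x
      using that i fi closed by simp
    show "(\<lambda>z\<in>B. f (snd X \<one>\<^bsub>G\<^esub> (?i z))) x = x" if "x \<in> B" for x
      using that i one_act by simp
    show "(\<lambda>z\<in>B. f (snd X (g \<otimes>\<^bsub>G\<^esub> h) (?i z))) x = (\<lambda>z\<in>B. f (snd X g (?i z))) ((\<lambda>z\<in>B. f (snd X h (?i z))) x)"
      if "g \<in> carrier G" "h \<in> carrier G" "x \<in> B" for g h x
      using that i fi closed by (simp add: composition_rule)
  qed auto
  hence "finite_gset G Z" using \<open>finite B\<close> by (simp add: finite_gset_def Z_def)
  moreover have "gset_iso G X Z"
    unfolding gset_iso_def using f fi by (intro exI[of _ f]) (auto simp: Z_def)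
  ultimately show thesis by (rule that)
qed


section \<open>Sums\<close>

lemma finite_gset_sum:
  assumes X: "finite_gset G X" and Y: "finite_gset G Y"
  shows "finite_gset G (gset_sum X Y)"
proof -
  interpret X: group_action G "fst X" "snd X" using X by (rule finite_gsetD)
  interpret Y: group_action G "fst Y" "snd Y" using Y by (rule finite_gsetD)
  interpret group G by (rule X.group_G)
  have "group_action G (fst (gset_sum X Y)) (snd (gset_sum X Y))"
    unfolding gset_sum_def fst_conv snd_conv
    by (rule group_actionI)
      (auto simp: X.closed Y.closed X.one_act Y.one_act X.composition_rule Y.composition_rule)
  thus ?thesis using X Y by (simp add: finite_gset_def gset_sum_def)
qed

lemma card_stabilizer_gset_sum:
  assumes X: "finite_gset G X" and Y: "finite_gset G Y"
  shows "card {z \<in> fst (gset_sum X Y). T (stabilizer G (snd (gset_sum X Y)) z)}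
           = card {x \<in> fst X. T (stabilizer G (snd X) x)} + card {y \<in> fst Y. T (stabilizer G (snd Y) y)}"
proof -
  have "stabilizer G (snd (gset_sum X Y)) (Inl x) = stabilizer G (snd X) x" if "x \<in> fst X" for x
    using that by (simp add: gset_sum_def stabilizer_def InlI)
  moreover have "stabilizer G (snd (gset_sum X Y)) (Inr y) = stabilizer G (snd Y) y" if "y \<in> fst Y" for y
    using that by (simp add: gset_sum_def stabilizer_def InrI)
  moreover have "fst (gset_sum X Y) = fst X <+> fst Y" by (simp add: gset_sum_def)
  ultimately have "{z \<in> fst (gset_sum X Y). T (stabilizer G (snd (gset_sum X Y)) z)}
      = {x \<in> fst X. T (stabilizer G (snd X) x)} <+> {y \<in> fst Y. T (stabilizer G (snd Y) y)}"
    by auto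
  thus ?thesis using X Y by (simp add: finite_gset_def card_Plus)
qed

lemma exact_gset_sum:
  "\<lbrakk>finite_gset G X; finite_gset G Y\<rbrakk> \<Longrightarrow> exact G (gset_sum X Y) R = exact G X R + exact G Y R"
  unfolding exact_def by (rule card_stabilizer_gset_sum)

lemma mark_gset_sum:
  "\<lbrakk>finite_gset G X; finite_gset G Y\<rbrakk> \<Longrightarrow> mark G (gset_sum X Y) R = mark G X R + mark G Y R"
  unfolding mark_def by (rule card_stabilizer_gset_sum)

text \<open>For empty \<open>I\<close> no summand tells that \<open>G\<close> is a group, hence the
  explicit assumption.\<close>

lemma finite_gset_Sum:
  assumes G: "group G" and I: "finite I" and Y: "\<And>i. i \<in> I \<Longrightarrow> finite_gset G (Y i)"
  shows "finite_gset G (gset_Sum I Y)"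
proof -
  interpret group G by fact
  have act: "group_action G (fst (Y i)) (snd (Y i))" if "i \<in> I" for i
    using Y[OF that] by (rule finite_gsetD)
  have "group_action G (fst (gset_Sum I Y)) (snd (gset_Sum I Y))"
    unfolding gset_Sum_def fst_conv snd_conv
    by (rule group_actionI)
      (auto simp: group_action.closed[OF act] group_action.one_act[OF act] group_action.composition_rule[OF act])
  thus ?thesis using I Y by (auto simp: finite_gset_def gset_Sum_def)
qed

lemma card_stabilizer_gset_Sum:
  assumes I: "finite I" and Y: "\<And>i. i \<in> I \<Longrightarrow> finite_gset G (Y i)"
  shows "card {z \<in> fst (gset_Sum I Y). T (stabilizer G (snd (gset_Sum I Y)) z)}
           = (\<Sum>i\<in>I. card {x \<in> fst (Y i). T (stabilizer G (snd (Y i)) x)})"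
proof -
  have "{z \<in> fst (gset_Sum I Y). T (stabilizer G (snd (gset_Sum I Y)) z)}
      = (SIGMA i:I. {x \<in> fst (Y i). T (stabilizer G (snd (Y i)) x)})"
    by (auto simp: gset_Sum_def stabilizer_def)
  thus ?thesis using I Y by (simp add: finite_gset_def)
qed

lemma exact_gset_Sum:
  "\<lbrakk>finite I; \<And>i. i \<in> I \<Longrightarrow> finite_gset G (Y i)\<rbrakk> \<Longrightarrow> exact G (gset_Sum I Y) R = (\<Sum>i\<in>I. exact G (Y i) R)"
  unfolding exact_def by (rule card_stabilizer_gset_Sum)

lemma mark_gset_Sum:
  "\<lbrakk>finite I; \<And>i. i \<in> I \<Longrightarrow> finite_gset G (Y i)\<rbrakk> \<Longrightarrow> mark G (gset_Sum I Y) R = (\<Sum>i\<in>I. mark G (Y i) R)"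
  unfolding mark_def by (rule card_stabilizer_gset_Sum)

text \<open>Holds over every element type: the constructions below start from an empty set over
  \<open>'x\<close>, whereas \<open>gset_empty\<close> lives over \<open>unit\<close>.\<close>

lemma (in group) finite_gset_empty_carrier: "fst X = {} \<Longrightarrow> \<forall>g. snd X g \<in> extensional {} \<Longrightarrow> finite_gset G X"
  unfolding finite_gset_def by (auto intro!: group_actionI)

lemma (in group) finite_gset_empty: "finite_gset G gset_empty"
  by (rule finite_gset_empty_carrier) (auto simp: gset_empty_def)


section \<open>Coset spaces and finite p-groups\<close>

definition coset_gset :: "('a, 'm) monoid_scheme \<Rightarrow> 'a set \<Rightarrow> ('a, 'a set) gset"
  where "coset_gset G Q =
           ((\<lambda>g. g <#\<^bsub>G\<^esub> Q) ` carrier G, \<lambda>g. \<lambda>A\<in>(\<lambda>g. g <#\<^bsub>G\<^esub> Q) ` carrier G. g <#\<^bsub>G\<^esub> A)"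

context group
begin

lemma coset_gset_point: "Q \<subseteq> carrier G \<Longrightarrow> Q \<in> fst (coset_gset G Q)"
  unfolding coset_gset_def by (simp add: image_iff) (metis lcos_mult_one one_closed)

lemma coset_gset_action:
  assumes Q: "Q \<subseteq> carrier G"
  shows "group_action G (fst (coset_gset G Q)) (snd (coset_gset G Q))"
  unfolding coset_gset_def fst_conv snd_conv
proof (rule group_actionI)
  let ?E = "(\<lambda>g. g <# Q) ` carrier G"
  have closed: "g <# A \<in> ?E" if "g \<in> carrier G" "A \<in> ?E" for g A
    using that Q by (auto simp: lcos_m_assoc)
  have sub: "A \<subseteq> carrier G" if "A \<in> ?E" for A
    using that Q l_coset_subset_G by blast
  show "(\<lambda>A\<in>?E. g <# A) A \<in> ?E" if "g \<in> carrier G" "A \<in> ?E" for g A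
    using closed that by simp
  show "(\<lambda>A\<in>?E. \<one> <# A) A = A" if "A \<in> ?E" for A
    using that sub[OF that] lcos_mult_one by simp
  show "(\<lambda>A\<in>?E. (g \<otimes> h) <# A) A = (\<lambda>A\<in>?E. g <# A) ((\<lambda>A\<in>?E. h <# A) A)"
    if "g \<in> carrier G" "h \<in> carrier G" "A \<in> ?E" for g h A
    using that closed[OF that(2,3)] sub[OF that(3)] lcos_m_assoc by simp
qed auto

lemma finite_coset_gset:
  "\<lbrakk>Q \<subseteq> carrier G; finite (carrier G)\<rbrakk> \<Longrightarrow> finite_gset G (coset_gset G Q)"
  using coset_gset_action by (simp add: finite_gset_def) (simp add: coset_gset_def)

lemma coset_gset_transitive:
  assumes Q: "Q \<subseteq> carrier G" and A: "A \<in> fst (coset_gset G Q)"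
  obtains g where "g \<in> carrier G" "A = snd (coset_gset G Q) g Q"
proof -
  obtain g where g: "g \<in> carrier G" "A = g <# Q" using A by (auto simp: coset_gset_def)
  moreover have "snd (coset_gset G Q) g Q = g <# Q"
    using coset_gset_point[OF Q] by (simp add: coset_gset_def)
  ultimately show thesis using that by simp
qed

lemma stabilizer_coset_gset:
  assumes Q: "subgroup Q G"
  shows "stabilizer G (snd (coset_gset G Q)) Q = Q"
proof -
  have QG: "Q \<subseteq> carrier G" using Q by (rule subgroup.subset)
  have "g <# Q = Q \<longleftrightarrow> g \<in> Q" if g: "g \<in> carrier G" for g
  proof
    assume "g <# Q = Q"
    moreover have "g \<otimes> \<one> \<in> g <# Q" using subgroup.one_closed[OF Q] unfolding l_coset_def by blast
    ultimately show "g \<in> Q" using g by simp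
  qed (use coset_join3 Q g in blast)
  hence "g \<in> carrier G \<and> g <# Q = Q \<longleftrightarrow> g \<in> Q" for g using QG by blast
  thus ?thesis using coset_gset_point[OF QG] by (simp add: stabilizer_def coset_gset_def)
qed

lemma card_coset_gset:
  assumes Q: "subgroup Q G"
  shows "card (fst (coset_gset G Q)) * card Q = order G"
proof -
  have QG: "Q \<subseteq> carrier G" using Q by (rule subgroup.subset)
  interpret C: group_action G "fst (coset_gset G Q)" "snd (coset_gset G Q)"
    using QG by (rule coset_gset_action)
  have "orbit G (snd (coset_gset G Q)) Q = fst (coset_gset G Q)"
    using coset_gset_transitive[OF QG] C.closed[OF _ coset_gset_point[OF QG]]
    by (auto simp: orbit_def)
  thus ?thesis
    using C.orbit_stabilizer_theorem[OF coset_gset_point[OF QG]] stabilizer_coset_gset[OF Q] by simp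
qed

text \<open>The stabilizer of the coset gQ is the conjugate of \<open>Q\<close> by \<open>g\<close>.
  This extracts group elements from fixed cosets, both for Sylow conjugation and for the growth of
  normalizers.\<close>

lemma coset_fixed:
  assumes Q: "subgroup Q G" and g: "g \<in> carrier G" and h: "h \<in> carrier G"
    and fixed: "h <# (g <# Q) = g <# Q"
  shows "inv g \<otimes> h \<otimes> g \<in> Q"
proof -
  have "h \<otimes> (g \<otimes> \<one>) \<in> h <# (g <# Q)"
    using subgroup.one_closed[OF Q] unfolding l_coset_def by blast
  hence "h \<otimes> g \<in> h <# (g <# Q)" using g by simp
  then obtain q where q: "q \<in> Q" "h \<otimes> g = g \<otimes> q" unfolding fixed by (auto simp: l_coset_def)
  have "inv g \<otimes> h \<otimes> g = inv g \<otimes> (g \<otimes> q)" using q(2) g h by (simp add: m_assoc)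
  also have "\<dots> = q" using g subgroup.mem_carrier[OF Q q(1)] by (simp add: m_assoc[symmetric])
  finally show ?thesis using q(1) by simp
qed

text \<open>The index of \<open>Q\<close> is prime to p, so a p-group acting on the cosets of
  \<open>Q\<close> fixes one of them. It acts through a homomorphism because the application is to
  the normalizer of a subgroup acting on another one by automorphisms.\<close>

lemma sylow_conjugate:
  assumes finG: "finite (carrier G)" and p: "prime p"
    and Q: "sylow_subgroup p Q G"
    and H: "group H" "order H = p ^ k" and \<theta>: "\<theta> \<in> hom H G"
  obtains g where "g \<in> carrier G" "\<And>h. h \<in> carrier H \<Longrightarrow> inv g \<otimes> \<theta> h \<otimes> g \<in> Q"
proof -
  have Q': "subgroup Q G" and cardQ: "card Q = p ^ multiplicity p (order G)"
    using Q by (auto simp: sylow_subgroup_def order_def)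
  have QG: "Q \<subseteq> carrier G" using Q' by (rule subgroup.subset)
  let ?E = "fst (coset_gset G Q)" and ?a = "snd (coset_gset G Q)"
  interpret C: group_action G ?E ?a using QG by (rule coset_gset_action)
  interpret D: group_action H ?E "\<lambda>h. ?a (\<theta> h)" by (rule C.pullback[OF H(1) \<theta>])
  have finE: "finite ?E" using finite_coset_gset[OF QG finG] by (rule finite_gsetD)
  let ?F = "{x \<in> ?E. \<forall>h\<in>carrier H. ?a (\<theta> h) x = x}"
  have "order G \<noteq> 0" using finG order_gt_0_iff_finite by simp
  \<comment> \<open>A factor p in the index would push the power of p in the group order beyond its
    multiplicity.\<close>
  have "\<not> p dvd card ?E"
  proof
    assume "p dvd card ?E"
    hence "p * card Q dvd order G" unfolding card_coset_gset[OF Q', symmetric] by (rule mult_dvd_mono) simp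
    hence "p ^ Suc (multiplicity p (order G)) dvd order G" using cardQ by simp
    thus False using \<open>order G \<noteq> 0\<close> p
      by (metis not_less_eq_eq power_dvd_iff_le_multiplicity not_prime_unit order_refl)
  qed
  moreover have "p dvd card (?E - ?F)" by (rule D.p_group_fixed_points[OF finE p H(2)])
  \<comment> \<open>Without a fixed coset the two sets would coincide, but p divides the size of
    only one of them.\<close>
  ultimately have "?E - ?F \<noteq> ?E" by metis
  hence "?F \<noteq> {}" by (metis Diff_empty)
  then obtain x where x: "x \<in> ?E" "\<And>h. h \<in> carrier H \<Longrightarrow> ?a (\<theta> h) x = x" by auto
  then obtain g where g: "g \<in> carrier G" "x = g <# Q" by (auto simp: coset_gset_def)
  have "inv g \<otimes> \<theta> h \<otimes> g \<in> Q" if h: "h \<in> carrier H" for h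
  proof (rule coset_fixed[OF Q' g(1)])
    show "\<theta> h \<in> carrier G" using \<theta> h by (auto simp: hom_def)
    show "\<theta> h <# (g <# Q) = g <# Q" using x(2)[OF h] x(1) g by (simp add: coset_gset_def)
  qed
  thus thesis using that g(1) by blast
qed

text \<open>Translation by \<open>g\<close> permutes the points and conjugates their
  stabilizers.\<close>

lemma card_stabilizer_conjugate:
  assumes X: "finite_gset G X" and g: "g \<in> carrier G"
    and T: "\<And>K. K \<subseteq> carrier G \<Longrightarrow> T' (conjugate G g K) \<longleftrightarrow> T K"
  shows "card {x \<in> fst X. T' (stabilizer G (snd X) x)} = card {x \<in> fst X. T (stabilizer G (snd X) x)}"
proof -
  interpret X: group_action G "fst X" "snd X" using X by (rule finite_gsetD)
  have *: "T' (stabilizer G (snd X) (snd X g x)) \<longleftrightarrow> T (stabilizer G (snd X) x)" if "x \<in> fst X" for x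
    using X.stabilizer_act[OF g that] T[OF X.stabilizer_subset] by simp
  have "snd X g ` {x \<in> fst X. T (stabilizer G (snd X) x)} = {x \<in> fst X. T' (stabilizer G (snd X) x)}"
  proof (intro equalityI subsetI)
    fix y assume y: "y \<in> {x \<in> fst X. T' (stabilizer G (snd X) x)}"
    have "snd X (inv g) y \<in> fst X" "y = snd X g (snd X (inv g) y)"
      using y g X.closed X.act_inv by auto
    thus "y \<in> snd X g ` {x \<in> fst X. T (stabilizer G (snd X) x)}"
      using y *[of "snd X (inv g) y"] by auto
  qed (use * X.closed[OF g] in auto)
  moreover have "inj_on (snd X g) {x \<in> fst X. T (stabilizer G (snd X) x)}"
    using X.inj_prop[OF g] by (rule inj_on_subset) auto
  hence "card (snd X g ` {x \<in> fst X. T (stabilizer G (snd X) x)})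
           = card {x \<in> fst X. T (stabilizer G (snd X) x)}" by (rule card_image)
  ultimately show ?thesis by simp
qed

lemma conjugate_subset_iff:
  assumes "A \<subseteq> carrier G" "B \<subseteq> carrier G" "g \<in> carrier G"
  shows "conjugate G g A \<subseteq> conjugate G g B \<longleftrightarrow> A \<subseteq> B"
proof
  assume "conjugate G g A \<subseteq> conjugate G g B"
  hence "conjugate G (inv g) (conjugate G g A) \<subseteq> conjugate G (inv g) (conjugate G g B)"
    unfolding conjugate_def by (rule image_mono)
  thus "A \<subseteq> B" using conjugate_inv assms by simp
qed (auto simp: conjugate_def)

lemma exact_conjugate:
  assumes "finite_gset G X" "g \<in> carrier G" "Q \<subseteq> carrier G"
  shows "exact G X (conjugate G g Q) = exact G X Q"
  unfolding exact_def
proof (rule card_stabilizer_conjugate[OF assms(1,2)])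
  fix K assume K: "K \<subseteq> carrier G"
  show "conjugate G g K = conjugate G g Q \<longleftrightarrow> K = Q"
    using conjugate_subset_iff[OF K assms(3,2)] conjugate_subset_iff[OF assms(3) K assms(2)]
    unfolding set_eq_subset by simp
qed

lemma mark_conjugate:
  assumes "finite_gset G X" "g \<in> carrier G" "Q \<subseteq> carrier G"
  shows "mark G X (conjugate G g Q) = mark G X Q"
  unfolding mark_def
  by (rule card_stabilizer_conjugate[OF assms(1,2)]) (rule conjugate_subset_iff[OF assms(3) _ assms(2)])

end

text \<open>The order of the Weyl group N(P)/P. It is also the number of points of G/P with
  stabilizer \<open>P\<close>, so the exact number at \<open>P\<close> grows by this amount with
  each orbit G/P.\<close>

definition weyl_order :: "('a, 'm) monoid_scheme \<Rightarrow> 'a set \<Rightarrow> nat"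
  where "weyl_order G P = card (normalizer G P) div card P"

text \<open>The stabilizers in G/R are the conjugates of \<open>R\<close>, and the points with
  stabilizer \<open>Q\<close> form a single orbit under the normalizer of \<open>Q\<close>, with
  point stabilizer \<open>Q\<close>.\<close>

lemma (in group) exact_coset_gset:
  assumes finG: "finite (carrier G)" and R: "subgroup R G" and Q: "subgroup Q G"
  shows "exact G (coset_gset G R) Q = (if \<exists>g\<in>carrier G. Q = conjugate G g R then weyl_order G Q else 0)"
proof -
  let ?E = "fst (coset_gset G R)" and ?a = "snd (coset_gset G R)"
  have RG: "R \<subseteq> carrier G" and QG: "Q \<subseteq> carrier G" using R Q subgroup.subset by auto
  interpret C: group_action G ?E ?a using RG by (rule coset_gset_action)
  have R': "R \<in> ?E" using RG by (rule coset_gset_point)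
  have stab: "stabilizer G ?a (?a g R) = conjugate G g R" if "g \<in> carrier G" for g
    using C.stabilizer_act[OF that R'] stabilizer_coset_gset[OF R] by simp
  let ?A = "{x \<in> ?E. stabilizer G ?a x = Q}"
  show ?thesis
  proof (cases "\<exists>g\<in>carrier G. Q = conjugate G g R")
    case False
    have "stabilizer G ?a x \<noteq> Q" if x: "x \<in> ?E" for x
    proof -
      obtain g where "g \<in> carrier G" "x = ?a g R" by (rule coset_gset_transitive[OF RG x])
      thus ?thesis using False stab by auto
    qed
    hence "?A = {}" by blast
    thus ?thesis using False unfolding exact_def by (simp only: card.empty if_False)
  next
    case True
    then obtain k where k: "k \<in> carrier G" "Q = conjugate G k R" by auto
    define x where "x = ?a k R"
    have x: "x \<in> ?E" "stabilizer G ?a x = Q" using k stab C.closed R' by (auto simp: x_def)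
    let ?N = "normalizer G Q"
    have N: "subgroup ?N G" using QG by (rule normalizer_imp_subgroup)
    have finQ: "finite Q" using finite_subset[OF QG finG] .
    have QN: "Q \<subseteq> ?N" using subset_normalizer[OF Q finQ] .
    interpret D: group_action "G\<lparr>carrier := ?N\<rparr>" ?E ?a using N by (rule C.restrict_subgroup)
    have "stabilizer (G\<lparr>carrier := ?N\<rparr>) ?a x = stabilizer G ?a x \<inter> ?N"
      using subgroup.subset[OF N] by (auto simp: stabilizer_def)
    hence stabN: "stabilizer (G\<lparr>carrier := ?N\<rparr>) ?a x = Q" using x QN by auto
    have "?A = orbit (G\<lparr>carrier := ?N\<rparr>) ?a x"
    proof (intro equalityI subsetI)
      fix y assume y: "y \<in> ?A"
      obtain h where h: "h \<in> carrier G" "y = ?a h R"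
        using y by (auto intro: coset_gset_transitive[OF RG])
      \<comment> \<open>Writing both points as translates of the base coset gives an element moving
        \<open>x\<close> to \<open>y\<close>; equal stabilizers force it to normalize
        \<open>Q\<close>.\<close>
      have "R = ?a (inv k) x" using C.inv_act[OF k(1) R'] by (simp add: x_def)
      hence y': "y = ?a (h \<otimes> inv k) x" using h k x by (simp add: C.composition_rule)
      hence "conjugate G (h \<otimes> inv k) Q = Q"
        using C.stabilizer_act[of "h \<otimes> inv k" x] h k x y by simp
      hence "h \<otimes> inv k \<in> ?N" using mem_normalizer_iff[OF QG] h k by simp
      thus "y \<in> orbit (G\<lparr>carrier := ?N\<rparr>) ?a x" using y' by (auto simp: orbit_def)
    next
      fix y assume "y \<in> orbit (G\<lparr>carrier := ?N\<rparr>) ?a x"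
      then obtain g where g: "g \<in> ?N" "y = ?a g x" by (auto simp: orbit_def)
      hence "g \<in> carrier G" "conjugate G g Q = Q" using mem_normalizer_iff[OF QG] by auto
      thus "y \<in> ?A" using g x C.closed[of g x] C.stabilizer_act[of g x] by simp
    qed
    moreover have "card (orbit (G\<lparr>carrier := ?N\<rparr>) ?a x) * card Q = card ?N"
      using D.orbit_stabilizer_theorem[OF x(1)] stabN by (simp add: order_def)
    moreover have "card Q > 0" using finQ subgroup.one_closed[OF Q] card_gt_0_iff by blast
    ultimately have "card ?A * card Q = card ?N" "card Q > 0" by simp_all
    hence "card ?A = weyl_order G Q"
      unfolding weyl_order_def by (metis nonzero_mult_div_cancel_right less_numeral_extra(3))
    thus ?thesis using True by (simp add: exact_def)
  qed
qed

section \<open>Finite p-groups: growth of normalizers and realizable stabilizer counts\<close>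

locale finite_p_group = group +
  fixes p :: nat
  assumes prime_p: "prime p"
    and finite_carrier: "finite (carrier G)"
    and p_group: "\<exists>n. card (carrier G) = p ^ n"
begin

lemma finite_subgroup: "subgroup P G \<Longrightarrow> finite P"
  using finite_subset[OF subgroup.subset finite_carrier] .

lemma card_subgroup_pos: "subgroup P G \<Longrightarrow> card P > 0"
  using finite_subgroup subgroup.one_closed card_gt_0_iff by blast

lemma card_subgroup:
  assumes "subgroup P G"
  obtains k where "card P = p ^ k"
proof -
  obtain n where n: "card (carrier G) = p ^ n" using p_group by blast
  have "card (rcosets P) * card P = card (carrier G)" using lagrange[OF assms] by (simp add: order_def)
  hence "card P dvd p ^ n" unfolding n[symmetric] by (rule dvdI[OF trans[OF sym mult.commute]])
  thus thesis using that divides_primepow_nat[OF prime_p] by blast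
qed

text \<open>\<open>P\<close> acts on the cosets R/P. The number of fixed cosets is divisible by p,
  and \<open>P\<close> itself is one of them, so there is another; its representative normalizes
  \<open>P\<close>.\<close>

lemma normalizer_grows:
  assumes P: "subgroup P G" and R: "subgroup R G" and PR: "P \<subset> R"
  obtains g where "g \<in> R" "g \<notin> P" "g \<in> normalizer G P"
proof -
  let ?R = "G\<lparr>carrier := R\<rparr>"
  interpret R: group ?R using R by (rule subgroup_imp_group)
  have PG: "P \<subseteq> carrier G" and RG: "R \<subseteq> carrier G" using P R subgroup.subset by auto
  have P': "subgroup P ?R" using subgroup_incl[OF P R] PR by auto
  have PR': "P \<subseteq> carrier ?R" using PR by auto
  let ?E = "fst (coset_gset ?R P)" and ?a = "snd (coset_gset ?R P)"
  interpret C: group_action ?R ?E ?a using PR' by (rule R.coset_gset_action)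
  interpret D: group_action "?R\<lparr>carrier := P\<rparr>" ?E ?a using P' by (rule C.restrict_subgroup)
  obtain k where k: "card P = p ^ k" using card_subgroup[OF P] .
  obtain l where l: "card R = p ^ l" using card_subgroup[OF R] .
  have finE: "finite ?E"
    using R.finite_coset_gset[OF PR'] finite_subgroup[OF R] by (simp add: finite_gset_def)
  let ?F = "{x \<in> ?E. \<forall>g\<in>carrier (?R\<lparr>carrier := P\<rparr>). ?a g x = x}"
  have "p dvd card (?E - ?F)"
    by (rule D.p_group_fixed_points[OF finE prime_p]) (simp add: order_def k)
  moreover have "p dvd card ?E"
  proof -
    have "card P < card R" using psubset_card_mono[OF finite_subgroup[OF R] PR] .
    hence "k < l" using k l prime_gt_1_nat[OF prime_p] power_less_imp_less_exp[of p k l] by simp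
    have "card ?E * p ^ k = p ^ l"
      using R.card_coset_gset[OF P'] k l by (simp add: order_def)
    also have "\<dots> = p ^ (l - k) * p ^ k" using \<open>k < l\<close> by (simp add: power_add[symmetric])
    finally have "card ?E = p ^ (l - k)" using prime_gt_0_nat[OF prime_p] by simp
    thus ?thesis using \<open>k < l\<close> by simp
  qed
  moreover have "card ?E = card (?E - ?F) + card ?F"
  proof -
    have F: "?F \<subseteq> ?E" by blast
    have "card (?E - ?F) = card ?E - card ?F" by (rule card_Diff_subset[OF finite_subset[OF F finE] F])
    moreover have "card ?F \<le> card ?E" by (rule card_mono[OF finE F])
    ultimately show ?thesis by linarith
  qed
  ultimately have dvdF: "p dvd card ?F" using dvd_add_right_iff[of p "card (?E - ?F)" "card ?F"] by argo
  have PF: "P \<in> ?F"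
  proof -
    have "g \<in> stabilizer ?R ?a P" if "g \<in> P" for g using R.stabilizer_coset_gset[OF P'] that by simp
    hence "?a g P = P" if "g \<in> P" for g using that unfolding stabilizer_def by blast
    thus ?thesis using R.coset_gset_point[OF PR'] by simp
  qed
  have "?F \<noteq> {P}"
  proof
    assume "?F = {P}"
    hence "card ?F = card {P}" by (rule arg_cong)
    thus False using dvdF prime_gt_1_nat[OF prime_p] by simp
  qed
  then obtain x where x: "x \<in> ?F" "x \<noteq> P" using PF by blast
  hence "x \<in> ?E" by blast
  then obtain g where g: "g \<in> R" "x = g <#\<^bsub>?R\<^esub> P" by (auto simp: coset_gset_def)
  have "g \<notin> P"
  proof
    assume "g \<in> P"
    hence "x = P" using g R.coset_join3[OF _ P', of g] by simp
    thus False using x by simp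
  qed
  have conj: "inv g \<otimes> h \<otimes> g \<in> P" if h: "h \<in> P" for h
  proof -
    have "?a h x = x" using x(1) h by simp
    moreover have "x \<in> ?E" using x(1) by blast
    hence "?a h x = h <#\<^bsub>?R\<^esub> x" by (simp add: coset_gset_def)
    ultimately have "inv\<^bsub>?R\<^esub> g \<otimes> h \<otimes> g \<in> P"
      using R.coset_fixed[OF P', of g h] g h PR by auto
    thus ?thesis using m_inv_consistent[OF R g(1)] by simp
  qed
  have gG: "g \<in> carrier G" using g(1) RG by auto
  \<comment> \<open>\<open>conj\<close> describes conjugation by \<open>inv g\<close>, so membership
    is obtained for the inverse first.\<close>
  have "inv g \<in> normalizer G P"
    using conj gG by (intro normalizerI[OF P finite_subgroup[OF P]]) auto
  moreover have "subgroup (normalizer G P) G" using PG by (rule normalizer_imp_subgroup)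
  ultimately have "g \<in> normalizer G P" using subgroup.m_inv_closed[of "normalizer G P" G "inv g"] gG by simp
  thus thesis using that g(1) \<open>g \<notin> P\<close> by blast
qed

text \<open>If the intersection is \<open>P\<close>, then \<open>P\<close> is self-normalizing in
  \<open>R\<close>, which cannot happen for a proper subgroup of a p-group.\<close>

lemma Int_normalizer_eq_iff:
  assumes P: "subgroup P G" and R: "subgroup R G"
  shows "R \<inter> normalizer G P = P \<longleftrightarrow> R = P"
proof
  assume *: "R \<inter> normalizer G P = P"
  show "R = P"
  proof (rule ccontr)
    assume "R \<noteq> P"
    hence "P \<subset> R" using * by auto
    then obtain g where "g \<in> R" "g \<notin> P" "g \<in> normalizer G P" using normalizer_grows[OF P R] by metis
    thus False using * by auto
  qed
qed (use subset_normalizer[OF P finite_subgroup[OF P]] in auto)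

lemma weyl_order_pos:
  assumes "subgroup P G"
  shows "weyl_order G P > 0"
proof -
  have "subgroup (normalizer G P) G" using normalizer_imp_subgroup[OF subgroup.subset[OF assms]] .
  hence "card P \<le> card (normalizer G P)"
    using subset_normalizer[OF assms finite_subgroup[OF assms]] finite_subgroup by (simp add: card_mono)
  thus ?thesis unfolding weyl_order_def using card_subgroup_pos[OF assms] by (simp add: div_greater_zero_iff)
qed

lemma normalizer_normal:
  assumes P: "subgroup P G"
  shows "subgroup P (G\<lparr>carrier := normalizer G P\<rparr>)"
    and "normalizer (G\<lparr>carrier := normalizer G P\<rparr>) P = carrier (G\<lparr>carrier := normalizer G P\<rparr>)"
proof -
  have PG: "P \<subseteq> carrier G" using P by (rule subgroup.subset)
  let ?N = "normalizer G P"
  have N: "subgroup ?N G" using PG by (rule normalizer_imp_subgroup)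
  have PN: "P \<subseteq> ?N" using subset_normalizer[OF P finite_subgroup[OF P]] .
  show "subgroup P (G\<lparr>carrier := ?N\<rparr>)" using subgroup_incl[OF P N PN] .
  interpret N: group "G\<lparr>carrier := ?N\<rparr>" using N by (rule subgroup_imp_group)
  have "conjugate (G\<lparr>carrier := ?N\<rparr>) g P = conjugate G g P" if "g \<in> ?N" for g
    using m_inv_consistent[OF N that] by (simp add: conjugate_def)
  thus "normalizer (G\<lparr>carrier := ?N\<rparr>) P = carrier (G\<lparr>carrier := ?N\<rparr>)"
    using N.mem_normalizer_iff[of P] PN mem_normalizer_iff[OF PG] by auto
qed

text \<open>Restricting the action to the normalizer intersects every stabilizer with it, which
  could create new points with stabilizer \<open>P\<close>. The growth of normalizers excludes
  this.\<close>

lemma exact_normalizer_eq: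
  assumes X: "finite_gset G X" and P: "subgroup P G"
  shows "exact (G\<lparr>carrier := normalizer G P\<rparr>) X P = exact G X P"
proof -
  interpret X: group_action G "fst X" "snd X" using X by (rule finite_gsetD)
  let ?N = "normalizer G P"
  have N: "subgroup ?N G" using normalizer_imp_subgroup[OF subgroup.subset[OF P]] .
  have "stabilizer (G\<lparr>carrier := ?N\<rparr>) (snd X) x = P \<longleftrightarrow> stabilizer G (snd X) x = P"
    if "x \<in> fst X" for x
  proof -
    have "stabilizer (G\<lparr>carrier := ?N\<rparr>) (snd X) x = stabilizer G (snd X) x \<inter> ?N"
      using subgroup.subset[OF N] by (auto simp: stabilizer_def)
    thus ?thesis using Int_normalizer_eq_iff[OF P X.stabilizer_subgroup[OF that]] by simp
  qed
  hence "{x \<in> fst X. stabilizer (G\<lparr>carrier := ?N\<rparr>) (snd X) x = P}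
           = {x \<in> fst X. stabilizer G (snd X) x = P}" by auto
  thus ?thesis unfolding exact_def by (rule arg_cong)
qed

text \<open>\<open>Y\<close> is an arbitrary set over the normalizer: the application is to one
  pulled back along a morphism of the fusion system, whose action does not come from
  restriction.\<close>

lemma weyl_order_dvd_exact_normalizer:
  assumes "finite_gset (G\<lparr>carrier := normalizer G P\<rparr>) Y" and P: "subgroup P G"
  shows "weyl_order G P dvd exact (G\<lparr>carrier := normalizer G P\<rparr>) Y P"
proof -
  let ?N = "G\<lparr>carrier := normalizer G P\<rparr>"
  interpret Y: group_action ?N "fst Y" "snd Y" using assms(1) by (rule finite_gsetD)
  have "finite (normalizer G P)"
    using finite_subgroup[OF normalizer_imp_subgroup[OF subgroup.subset[OF P]]] .
  hence "(order ?N div card P) dvd card {x \<in> fst Y. stabilizer ?N (snd Y) x = P}"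
    using normalizer_normal[OF P] finite_gsetD(1)[OF assms(1)]
    by (intro Y.index_dvd_card_stabilizer_eq) auto
  thus ?thesis by (simp add: weyl_order_def exact_def order_def)
qed

lemma restrict_finite_gset:
  assumes "finite_gset G X" "subgroup H G"
  shows "finite_gset (G\<lparr>carrier := H\<rparr>) X"
  using assms group_action.restrict_subgroup unfolding finite_gset_def by blast

lemma weyl_order_dvd_exact:
  assumes X: "finite_gset G X" and P: "subgroup P G"
  shows "weyl_order G P dvd exact G X P"
  using weyl_order_dvd_exact_normalizer[OF restrict_finite_gset[OF X] P]
    exact_normalizer_eq[OF X P] normalizer_imp_subgroup[OF subgroup.subset[OF P]] by simp

text \<open>Both conditions hold for the counts of every finite set with action. Conversely, orbits
  G/R are peeled off as long as some \<open>e R\<close> is nonzero, with the total of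
  \<open>e\<close> decreasing.\<close>

lemma exact_realization:
  assumes conj: "\<And>R g. \<lbrakk>subgroup R G; g \<in> carrier G\<rbrakk> \<Longrightarrow> e (conjugate G g R) = e R"
    and dvd: "\<And>R. subgroup R G \<Longrightarrow> weyl_order G R dvd e R"
  shows "\<exists>X :: ('a, 'x :: infinite) gset. finite_gset G X \<and> (\<forall>R. subgroup R G \<longrightarrow> exact G X R = e R)"
  using assms
proof (induction "\<Sum>R | subgroup R G. e R" arbitrary: e rule: less_induct)
  case less
  have fin: "finite {R. subgroup R G}" using finite_subgroups[OF finite_carrier, of "\<lambda>_. True"] by simp
  show ?case
  proof (cases "\<forall>R. subgroup R G \<longrightarrow> e R = 0")
    case True
    let ?X = "({}, \<lambda>g. \<lambda>x\<in>{}. x) :: ('a, 'x) gset"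
    have "finite_gset G ?X" by (rule finite_gset_empty_carrier) auto
    thus ?thesis using True by (intro exI[of _ ?X]) (simp add: exact_def)
  next
    case False
    then obtain R where R: "subgroup R G" "e R \<noteq> 0" by auto
    let ?C = "coset_gset G R"
    have C: "finite_gset G ?C" using finite_coset_gset[OF subgroup.subset[OF R(1)] finite_carrier] .
    \<comment> \<open>The natural subtraction below loses nothing: on the conjugates of
      \<open>R\<close> the value of \<open>e\<close> is a nonzero multiple of
      \<open>weyl_order\<close>, and elsewhere G/R contributes 0.\<close>
    have le: "exact G ?C Q \<le> e Q" if Q: "subgroup Q G" for Q
    proof (cases "\<exists>g\<in>carrier G. Q = conjugate G g R")
      case True
      hence "e Q \<noteq> 0" using less.prems(1)[OF R(1)] R(2) by auto
      thus ?thesis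
        using True less.prems(2)[OF Q] exact_coset_gset[OF finite_carrier R(1) Q]
        by (simp add: dvd_imp_le)
    qed (use exact_coset_gset[OF finite_carrier R(1) Q] in simp)
    define e' where "e' Q = e Q - exact G ?C Q" for Q
    have "R = conjugate G \<one> R" using conjugate_one[OF subgroup.subset[OF R(1)]] by simp
    hence "\<exists>g\<in>carrier G. R = conjugate G g R" by blast
    hence "exact G ?C R > 0"
      using exact_coset_gset[OF finite_carrier R(1) R(1)] weyl_order_pos[OF R(1)] by simp
    hence "e' R < e R" using R(2) unfolding e'_def by simp
    have "\<exists>X :: ('a, 'x) gset. finite_gset G X \<and> (\<forall>R. subgroup R G \<longrightarrow> exact G X R = e' R)"
    proof (rule less.hyps)
      show "(\<Sum>R | subgroup R G. e' R) < (\<Sum>R | subgroup R G. e R)"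
        using fin R(1) \<open>e' R < e R\<close> by (intro sum_strict_mono_ex1) (auto simp: e'_def)
      show "e' (conjugate G g Q) = e' Q" if "subgroup Q G" "g \<in> carrier G" for Q g
        unfolding e'_def using less.prems(1)[OF that] exact_conjugate[OF C that(2) subgroup.subset[OF that(1)]]
        by simp
      show "weyl_order G Q dvd e' Q" if "subgroup Q G" for Q
        unfolding e'_def using less.prems(2)[OF that] weyl_order_dvd_exact[OF C that] by (rule dvd_diff_nat)
    qed
    then obtain Y :: "('a, 'x) gset" where Y: "finite_gset G Y" "\<And>R. subgroup R G \<Longrightarrow> exact G Y R = e' R"
      by blast
    have YC: "finite_gset G (gset_sum Y ?C)" using Y(1) C by (rule finite_gset_sum)
    \<comment> \<open>The sum lives over a sum type and has to return to \<open>'x\<close> for the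
      induction.\<close>
    obtain X :: "('a, 'x) gset" where X: "finite_gset G X" "gset_iso G (gset_sum Y ?C) X"
      using gset_transport[OF YC] .
    have "exact G X Q = e Q" if Q: "subgroup Q G" for Q
      using exact_iso[OF YC X(2), of Q] exact_gset_sum[OF Y(1) C, of Q] Y(2)[OF Q] le[OF Q] by (simp add: e'_def)
    thus ?thesis using X(1) by blast
  qed
qed

end


section \<open>Fusion systems\<close>

sublocale fusion_system \<subseteq> finite_p_group S p
  by unfold_locales (fact prime_p finite_carrier p_group)+

context fusion_system
begin

lemma subgroup_carrier: "subgroup (carrier S) S"
  by (rule subgroup_self)

lemma conj_hom_one: "P \<subseteq> carrier S \<Longrightarrow> conj_hom S P \<one> = (\<lambda>x\<in>P. x)"
  unfolding conj_hom_def by (rule restrict_ext) auto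

lemma conj_hom_image: "conj_hom S P s ` P = conjugate S s P"
  unfolding conj_hom_def conjugate_def by (rule image_cong) auto

lemma inclusion_morphism:
  assumes "subgroup P S" "subgroup Q S" "P \<subseteq> Q"
  shows "(\<lambda>x\<in>P. x) \<in> F P Q"
  using morphism_conj[OF assms(1,2) one_closed] conj_hom_one[OF subgroup.subset[OF assms(1)]] assms(3)
  by simp

lemma morphism_closed: "\<lbrakk>subgroup P S; subgroup Q S; \<phi> \<in> F P Q; x \<in> P\<rbrakk> \<Longrightarrow> \<phi> x \<in> Q"
  using morphism_hom by (fastforce simp: hom_def)

lemma morphism_mult:
  "\<lbrakk>subgroup P S; subgroup Q S; \<phi> \<in> F P Q; x \<in> P; y \<in> P\<rbrakk> \<Longrightarrow> \<phi> (x \<otimes> y) = \<phi> x \<otimes> \<phi> y"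
  using morphism_hom by (fastforce simp: hom_def)

lemma morphism_extend:
  assumes P: "subgroup P S" and Q: "subgroup Q S" and R: "subgroup R S" and QR: "Q \<subseteq> R"
    and \<phi>: "\<phi> \<in> F P Q"
  shows "\<phi> \<in> F P R"
proof -
  have "compose P (\<lambda>x\<in>Q. x) \<phi> \<in> F P R"
    using morphism_comp[OF P Q R \<phi> inclusion_morphism[OF Q R QR]] .
  moreover have "compose P (\<lambda>x\<in>Q. x) \<phi> = \<phi>"
    using morphism_closed[OF P Q \<phi>] morphism_ext[OF P Q \<phi>]
    by (intro extensionalityI[where A = P]) (auto simp: compose_def)
  ultimately show ?thesis by simp
qed

lemmas morphism_into_carrier = morphism_extend[OF _ _ subgroup_carrier subgroup.subset]

lemma morphism_restrict:
  assumes P: "subgroup P S" and Q: "subgroup Q S" and R: "subgroup R S" and RP: "R \<subseteq> P"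
    and \<phi>: "\<phi> \<in> F P Q"
  shows "restrict \<phi> R \<in> F R Q"
proof -
  have "compose R \<phi> (\<lambda>x\<in>R. x) \<in> F R Q"
    using morphism_comp[OF R P Q inclusion_morphism[OF R P RP] \<phi>] .
  moreover have "compose R \<phi> (\<lambda>x\<in>R. x) = restrict \<phi> R"
    by (rule ext) (simp add: compose_def)
  ultimately show ?thesis by simp
qed

lemma morphism_group_hom:
  assumes "subgroup P S" "subgroup Q S" "\<phi> \<in> F P Q"
  shows "group_hom (S\<lparr>carrier := P\<rparr>) S \<phi>"
  unfolding group_hom_def group_hom_axioms_def
  using assms subgroup_imp_group[OF assms(1)] is_group morphism_mult[OF assms]
    morphism_closed[OF assms] subgroup.subset[OF assms(2)]
  by (auto simp: hom_def)

lemma morphism_image_subgroup: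
  assumes "subgroup P S" "subgroup Q S" "\<phi> \<in> F P Q"
  shows "subgroup (\<phi> ` P) S"
  using group_hom.img_is_subgroup[OF morphism_group_hom[OF assms]] by simp

lemma card_morphism_image:
  assumes "subgroup P S" "subgroup Q S" "\<phi> \<in> F P Q"
  shows "card (\<phi> ` P) = card P"
  using morphism_inj[OF assms] by (rule card_image)

text \<open>Corestriction and inversion turn any morphism into an isomorphism onto its image. A
  single morphism into \<open>carrier S\<close> is also the form in which stability and the
  extension axiom are stated.\<close>

lemma fusion_conj_iff:
  assumes P: "subgroup P S" and Q: "subgroup Q S"
  shows "fusion_conj F P Q \<longleftrightarrow> (\<exists>\<phi>\<in>F P (carrier S). \<phi> ` P = Q)"
proof
  assume "fusion_conj F P Q"
  then obtain \<phi> \<psi> where \<phi>: "\<phi> \<in> F P Q" and \<psi>: "\<psi> \<in> F Q P" and eq: "compose Q \<phi> \<psi> = (\<lambda>x\<in>Q. x)"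
    by (auto simp: fusion_conj_def)
  have "x \<in> \<phi> ` P" if "x \<in> Q" for x
  proof -
    have "\<phi> (\<psi> x) = x" using fun_cong[OF eq, of x] that by (simp add: compose_def)
    moreover have "\<psi> x \<in> P" using morphism_closed[OF Q P \<psi> that] .
    ultimately show ?thesis by (metis imageI)
  qed
  hence "\<phi> ` P = Q" using morphism_closed[OF P Q \<phi>] by blast
  thus "\<exists>\<phi>\<in>F P (carrier S). \<phi> ` P = Q" using morphism_into_carrier[OF P Q Q \<phi>] by blast
next
  assume "\<exists>\<phi>\<in>F P (carrier S). \<phi> ` P = Q"
  then obtain \<phi> where \<phi>: "\<phi> \<in> F P (carrier S)" "\<phi> ` P = Q" by blast
  let ?\<psi> = "restrict (inv_into P \<phi>) Q"
  have inj: "inj_on \<phi> P" using morphism_inj[OF P subgroup_carrier \<phi>(1)] .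
  have "\<phi> \<in> F P Q" "?\<psi> \<in> F Q P"
    using morphism_corestrict[OF P subgroup_carrier \<phi>(1)] morphism_inverse[OF P subgroup_carrier \<phi>(1)] \<phi>(2)
    by simp_all
  moreover have "compose P ?\<psi> \<phi> = (\<lambda>x\<in>P. x)"
    using inj \<phi>(2) by (auto simp: compose_def intro!: restrict_ext)
  moreover have "compose Q \<phi> ?\<psi> = (\<lambda>x\<in>Q. x)"
    using \<phi>(2) by (auto simp: compose_def f_inv_into_f intro!: restrict_ext)
  ultimately show "fusion_conj F P Q" unfolding fusion_conj_def by blast
qed

lemma fusion_conj_refl: "subgroup P S \<Longrightarrow> fusion_conj F P P"
  using inclusion_morphism[OF _ subgroup_carrier subgroup.subset, of P]
  by (auto simp: fusion_conj_iff intro!: bexI[of _ "\<lambda>x\<in>P. x"])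

lemma fusion_conj_sym: "fusion_conj F P Q \<Longrightarrow> fusion_conj F Q P"
  unfolding fusion_conj_def by blast

lemma fusion_conj_trans:
  assumes P: "subgroup P S" and Q: "subgroup Q S" and R: "subgroup R S"
    and "fusion_conj F P Q" "fusion_conj F Q R"
  shows "fusion_conj F P R"
proof -
  obtain \<phi> where \<phi>: "\<phi> \<in> F P (carrier S)" "\<phi> ` P = Q" using assms by (auto simp: fusion_conj_iff)
  obtain \<psi> where \<psi>: "\<psi> \<in> F Q (carrier S)" "\<psi> ` Q = R" using assms by (auto simp: fusion_conj_iff)
  have "\<phi> \<in> F P Q" using morphism_corestrict[OF P subgroup_carrier \<phi>(1)] \<phi>(2) by simp
  hence "compose P \<psi> \<phi> \<in> F P (carrier S)" by (rule morphism_comp[OF P Q subgroup_carrier _ \<psi>(1)])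
  moreover have "compose P \<psi> \<phi> ` P = R" using \<phi>(2) \<psi>(2) by (auto simp: compose_def image_image)
  ultimately show ?thesis using fusion_conj_iff[OF P R] by blast
qed

lemma card_fusion_conj:
  assumes "subgroup P S" "subgroup Q S" "fusion_conj F P Q"
  shows "card Q = card P"
  using assms card_morphism_image[OF assms(1) subgroup_carrier] by (auto simp: fusion_conj_iff)

lemma mem_conj_class_self: "subgroup P S \<Longrightarrow> P \<in> conj_class S F P"
  by (simp add: conj_class_def fusion_conj_refl)

lemma conj_class_eq_iff:
  assumes P: "subgroup P S" and Q: "subgroup Q S"
  shows "conj_class S F P = conj_class S F Q \<longleftrightarrow> fusion_conj F P Q"
proof
  assume "conj_class S F P = conj_class S F Q"
  hence "Q \<in> conj_class S F P" using mem_conj_class_self[OF Q] by simp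
  thus "fusion_conj F P Q" by (simp add: conj_class_def)
next
  assume "fusion_conj F P Q"
  thus "conj_class S F P = conj_class S F Q"
    unfolding conj_class_def using fusion_conj_trans fusion_conj_sym P Q by blast
qed

lemma conjugate_fusion_conj:
  assumes P: "subgroup P S" and s: "s \<in> carrier S"
  shows "fusion_conj F P (conjugate S s P)"
proof -
  have "conj_hom S P s \<in> F P (carrier S)"
    using conj_hom_image subgroup.subset[OF conjugate_subgroup[OF P s]]
    by (intro morphism_conj[OF P subgroup_carrier s]) simp
  thus ?thesis using fusion_conj_iff[OF P conjugate_subgroup[OF P s]] conj_hom_image by blast
qed

lemma finite_conj_classes: "finite (conj_classes S F)"
  using finite_subgroups[OF finite_carrier, of "\<lambda>_. True"] by (simp add: conj_classes_def)

definition class_rep :: "'a set set \<Rightarrow> 'a set"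
  where "class_rep C = (SOME P. subgroup P S \<and> conj_class S F P = C \<and> fully_normalized S F P)"

lemma class_rep:
  assumes "C \<in> conj_classes S F"
  shows "subgroup (class_rep C) S" "conj_class S F (class_rep C) = C" "fully_normalized S F (class_rep C)"
proof -
  obtain Q where Q: "subgroup Q S" "C = conj_class S F Q" using assms by (auto simp: conj_classes_def)
  have "finite C"
    using finite_subgroups[OF finite_carrier, of "\<lambda>_. True"]
    by (rule rev_finite_subset) (auto simp: Q(2) conj_class_def)
  moreover have "C \<noteq> {}" using mem_conj_class_self Q by auto
  ultimately obtain P where P: "P \<in> C" "\<forall>R\<in>C. card (normalizer S R) \<le> card (normalizer S P)"
    using obtains_MAX[of C "\<lambda>R. card (normalizer S R)"] by (metis (no_types, lifting) Max_ge finite_imageI imageI)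
  have "subgroup P S" "fusion_conj F Q P" using P(1) Q(2) by (auto simp: conj_class_def)
  moreover from this have "conj_class S F P = C"
    using conj_class_eq_iff Q fusion_conj_sym by metis
  ultimately have "\<exists>P. subgroup P S \<and> conj_class S F P = C \<and> fully_normalized S F P"
    using P(2) unfolding fully_normalized_def by metis
  hence "subgroup (class_rep C) S \<and> conj_class S F (class_rep C) = C \<and> fully_normalized S F (class_rep C)"
    unfolding class_rep_def by (rule someI_ex)
  thus "subgroup (class_rep C) S" "conj_class S F (class_rep C) = C" "fully_normalized S F (class_rep C)"
    by auto
qed

text \<open>An injective self-map of a finite set is bijective, so endomorphisms are
  automorphisms.\<close>

lemma Aut_fusion_subset_Bij:
  assumes P: "subgroup P S"
  shows "F P P \<subseteq> Bij P"
proof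
  fix \<phi> assume \<phi>: "\<phi> \<in> F P P"
  have "\<phi> ` P \<subseteq> P" using morphism_closed[OF P P \<phi>] by auto
  hence "\<phi> ` P = P" using endo_inj_surj[OF finite_subgroup[OF P] _ morphism_inj[OF P P \<phi>]] by simp
  thus "\<phi> \<in> Bij P" using morphism_inj[OF P P \<phi>] morphism_ext[OF P P \<phi>] by (simp add: Bij_def bij_betw_def)
qed

lemma group_Aut_fusion:
  assumes P: "subgroup P S"
  shows "group (Aut_fusion F P)"
  unfolding Aut_fusion_def
proof (rule group.subgroup_imp_group[OF group_BijGroup], rule group.subgroupI[OF group_BijGroup])
  note Bij = subsetD[OF Aut_fusion_subset_Bij[OF P]]
  show "F P P \<subseteq> carrier (BijGroup P)" using Bij by (auto simp: BijGroup_def)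
  show "F P P \<noteq> {}" using inclusion_morphism[OF P P] by auto
  show "inv\<^bsub>BijGroup P\<^esub> \<phi> \<in> F P P" if "\<phi> \<in> F P P" for \<phi>
    using morphism_inverse[OF P P that] Bij[OF that] inv_BijGroup[OF Bij[OF that]]
    by (simp add: Bij_def bij_betw_def)
  show "\<phi> \<otimes>\<^bsub>BijGroup P\<^esub> \<psi> \<in> F P P" if "\<phi> \<in> F P P" "\<psi> \<in> F P P" for \<phi> \<psi>
    using morphism_comp[OF P P P that(2,1)] Bij that by (simp add: BijGroup_def)
qed

lemma Aut_fusion_mult:
  assumes P: "subgroup P S" and "\<phi> \<in> F P P" "\<psi> \<in> F P P" "u \<in> P"
  shows "(\<phi> \<otimes>\<^bsub>Aut_fusion F P\<^esub> \<psi>) u = \<phi> (\<psi> u)"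
  using assms Aut_fusion_subset_Bij[OF P] by (auto simp: Aut_fusion_def BijGroup_def compose_def)

lemma Aut_fusion_one: "u \<in> P \<Longrightarrow> \<one>\<^bsub>Aut_fusion F P\<^esub> u = u"
  by (simp add: Aut_fusion_def BijGroup_def)

lemma carrier_Aut_fusion [simp]: "carrier (Aut_fusion F P) = F P P"
  by (simp add: Aut_fusion_def)

lemma finite_Aut_fusion: "subgroup P S \<Longrightarrow> finite (F P P)"
proof (rule finite_subset)
  assume P: "subgroup P S"
  show "F P P \<subseteq> P \<rightarrow>\<^sub>E P"
  proof
    fix \<phi> assume "\<phi> \<in> F P P"
    hence "\<phi> \<in> Bij P" using Aut_fusion_subset_Bij[OF P] by blast
    thus "\<phi> \<in> P \<rightarrow>\<^sub>E P" unfolding PiE_def using Bij_imp_funcset Bij_imp_extensional by (intro IntI)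
  qed
  show "finite (P \<rightarrow>\<^sub>E P)" using finite_subgroup[OF P] by (simp add: finite_PiE)
qed

end

section \<open>Saturation: morphisms out of normalizers and the congruence of marks\<close>

context saturated_fusion_system
begin

text \<open>An isomorphism from \<open>Q\<close> to \<open>P\<close> carries the conjugations by the
  normalizer of \<open>Q\<close> to a p-group of automorphisms of \<open>P\<close>. Since
  \<open>Aut_conj S P\<close> is Sylow, an automorphism of \<open>P\<close> conjugates that p-group
  into it. The isomorphism corrected by this automorphism has the whole normalizer as its extender,
  and the extension axiom applies because \<open>P\<close> is also fully centralized.\<close>

lemma morphism_to_fully_normalized:
  assumes P: "subgroup P S" and fn: "fully_normalized S F P"
    and Q: "subgroup Q S" and QP: "fusion_conj F Q P"
  obtains \<phi> where "\<phi> \<in> F (normalizer S Q) (carrier S)" "\<phi> ` Q = P"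
proof -
  note car = subgroup_carrier
  let ?N = "normalizer S Q" and ?A = "Aut_fusion F P"
  have QS: "Q \<subseteq> carrier S" and PS: "P \<subseteq> carrier S" using P Q subgroup.subset by auto
  have N: "subgroup ?N S" using QS by (rule normalizer_imp_subgroup)
  have normal: "x \<otimes> v \<otimes> inv x \<in> Q" if "x \<in> ?N" "v \<in> Q" for x v
    using that mem_normalizer_iff[OF QS] unfolding conjugate_def by blast
  interpret A: group ?A using P by (rule group_Aut_fusion)
  obtain \<psi> where \<psi>: "\<psi> \<in> F Q (carrier S)" "\<psi> ` Q = P" using QP fusion_conj_iff[OF Q P] by blast
  have \<psi>': "\<psi> \<in> F Q P" using morphism_corestrict[OF Q car \<psi>(1)] \<psi>(2) by simp
  define \<chi> where "\<chi> = restrict (inv_into Q \<psi>) P"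
  have \<chi>: "\<chi> \<in> F P Q" using morphism_inverse[OF Q car \<psi>(1)] \<psi>(2) by (simp add: \<chi>_def)
  have \<chi>\<psi>: "\<chi> (\<psi> v) = v" if "v \<in> Q" for v
    using that \<psi>(2) morphism_inj[OF Q car \<psi>(1)] by (auto simp: \<chi>_def)
  have \<psi>\<chi>: "\<psi> (\<chi> u) = u" "\<chi> u \<in> Q" if "u \<in> P" for u
    using that \<psi>(2) by (auto simp: \<chi>_def f_inv_into_f inv_into_into)
  \<comment> \<open>\<open>\<theta> x\<close> is the conjugation by \<open>x\<close>, moved from
    \<open>Q\<close> to \<open>P\<close> along \<open>\<psi>\<close>; \<open>\<chi>\<close> is the
    inverse of \<open>\<psi>\<close>.\<close>
  define \<theta> where "\<theta> x = compose P \<psi> (compose P (conj_hom S Q x) \<chi>)" for x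
  have \<theta>_eq: "\<theta> x u = \<psi> (x \<otimes> \<chi> u \<otimes> inv x)" if "u \<in> P" for x u
    using that \<psi>\<chi> by (simp add: \<theta>_def compose_def conj_hom_def)
  have \<theta>_mem: "\<theta> x \<in> F P P" if x: "x \<in> ?N" for x
  proof -
    have "x \<in> carrier S" "conj_hom S Q x ` Q \<subseteq> Q"
      using x mem_normalizer_iff[OF QS] conj_hom_image by auto
    hence "conj_hom S Q x \<in> F Q Q" by (intro morphism_conj[OF Q Q])
    thus ?thesis unfolding \<theta>_def
      by (intro morphism_comp[OF P Q P _ \<psi>'] morphism_comp[OF P Q Q \<chi>])
  qed
  have \<theta>_mult: "\<theta> (x \<otimes> y) = \<theta> x \<otimes>\<^bsub>?A\<^esub> \<theta> y" if x: "x \<in> ?N" and y: "y \<in> ?N" for x y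
  proof (rule extensionalityI[where A = P])
    have xy: "x \<otimes> y \<in> ?N" using subgroup.m_closed[OF N x y] .
    show "\<theta> (x \<otimes> y) \<in> extensional P" using morphism_ext[OF P P \<theta>_mem[OF xy]] .
    have "\<theta> x \<otimes>\<^bsub>?A\<^esub> \<theta> y \<in> F P P" using A.m_closed \<theta>_mem x y by simp
    thus "\<theta> x \<otimes>\<^bsub>?A\<^esub> \<theta> y \<in> extensional P" by (rule morphism_ext[OF P P])
    fix u assume u: "u \<in> P"
    have xyS: "x \<in> carrier S" "y \<in> carrier S" "\<chi> u \<in> carrier S"
      using x y \<psi>\<chi>(2)[OF u] mem_normalizer_iff[OF QS] QS by auto
    have "(\<theta> x \<otimes>\<^bsub>?A\<^esub> \<theta> y) u = \<theta> x (\<theta> y u)" using Aut_fusion_mult[OF P \<theta>_mem[OF x] \<theta>_mem[OF y] u] .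
    also have "\<theta> y u = \<psi> (y \<otimes> \<chi> u \<otimes> inv y)" using \<theta>_eq[OF u] .
    also have "\<theta> x (\<psi> (y \<otimes> \<chi> u \<otimes> inv y)) = \<psi> (x \<otimes> (y \<otimes> \<chi> u \<otimes> inv y) \<otimes> inv x)"
      using \<theta>_eq[of "\<psi> (y \<otimes> \<chi> u \<otimes> inv y)" x] \<chi>\<psi>[OF normal[OF y \<psi>\<chi>(2)[OF u]]]
        morphism_closed[OF Q P \<psi>' normal[OF y \<psi>\<chi>(2)[OF u]]] by simp
    also have "\<dots> = \<theta> (x \<otimes> y) u" using \<theta>_eq[OF u] conj_mult[OF xyS] by simp
    finally show "\<theta> (x \<otimes> y) u = (\<theta> x \<otimes>\<^bsub>?A\<^esub> \<theta> y) u" by simp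
  qed
  have hom: "\<theta> \<in> hom (S\<lparr>carrier := ?N\<rparr>) ?A" using \<theta>_mem \<theta>_mult by (auto simp: hom_def)
  obtain k where k: "card ?N = p ^ k" using card_subgroup[OF N] .
  have sylow: "fully_centralized S F P" "sylow_subgroup p (Aut_conj S P) ?A"
    using sylow_axiom[OF P fn] by auto
  obtain \<gamma> where \<gamma>: "\<gamma> \<in> F P P" "\<And>x. x \<in> ?N \<Longrightarrow> inv\<^bsub>?A\<^esub> \<gamma> \<otimes>\<^bsub>?A\<^esub> \<theta> x \<otimes>\<^bsub>?A\<^esub> \<gamma> \<in> Aut_conj S P"
    using A.sylow_conjugate[OF _ prime_p sylow(2) subgroup_imp_group[OF N] _ hom, of k]
      finite_Aut_fusion[OF P] k by (auto simp: order_def)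
  define \<delta> where "\<delta> = inv\<^bsub>?A\<^esub> \<gamma>"
  have \<delta>: "\<delta> \<in> F P P" using A.inv_closed \<gamma>(1) by (simp add: \<delta>_def)
  have \<gamma>\<delta>: "\<gamma> (\<delta> u) = u" if "u \<in> P" for u
  proof -
    have "\<gamma> \<otimes>\<^bsub>?A\<^esub> \<delta> = \<one>\<^bsub>?A\<^esub>" using A.r_inv \<gamma>(1) by (simp add: \<delta>_def)
    thus ?thesis using Aut_fusion_mult[OF P \<gamma>(1) \<delta> that] Aut_fusion_one[OF that] by simp
  qed
  \<comment> \<open>Conjugating c_x with this map gives \<open>\<delta>\<close> times
    \<open>\<theta> x\<close> times \<open>\<gamma>\<close>, which lies in
    \<open>Aut_conj S P\<close> and therefore is conjugation by some \<open>y\<close>. This is the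
    condition for \<open>x\<close> to be in the extender.\<close>
  define \<phi> where "\<phi> = compose Q \<delta> \<psi>"
  have \<phi>_eq: "\<phi> v = \<delta> (\<psi> v)" if "v \<in> Q" for v using that by (simp add: \<phi>_def compose_def)
  have \<phi>: "\<phi> \<in> F Q (carrier S)"
    unfolding \<phi>_def using morphism_into_carrier[OF Q P P] morphism_comp[OF Q P P \<psi>' \<delta>] by blast
  have "\<delta> ` P = P" using \<delta> Aut_fusion_subset_Bij[OF P] by (auto simp: Bij_def bij_betw_def)
  hence \<phi>Q: "\<phi> ` Q = P" using \<phi>_eq \<psi>(2) by (metis (no_types, lifting) image_cong image_image)
  have "extender S Q \<phi> = ?N"
  proof
    show "?N \<subseteq> extender S Q \<phi>"
    proof
      fix x assume x: "x \<in> ?N"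
      have "\<delta> \<otimes>\<^bsub>?A\<^esub> \<theta> x \<otimes>\<^bsub>?A\<^esub> \<gamma> \<in> Aut_conj S P" using \<gamma>(2)[OF x] by (simp add: \<delta>_def)
      then obtain y where y: "y \<in> normalizer S P" "\<delta> \<otimes>\<^bsub>?A\<^esub> \<theta> x \<otimes>\<^bsub>?A\<^esub> \<gamma> = conj_hom S P y"
        by (auto simp: Aut_conj_def)
      have "\<phi> (x \<otimes> v \<otimes> inv x) = y \<otimes> \<phi> v \<otimes> inv y" if v: "v \<in> Q" for v
      proof -
        have \<psi>v: "\<psi> v \<in> P" and \<phi>v: "\<phi> v \<in> P" using morphism_closed[OF Q P \<psi>' v] \<phi>Q v by auto
        have "y \<otimes> \<phi> v \<otimes> inv y = (\<delta> \<otimes>\<^bsub>?A\<^esub> \<theta> x \<otimes>\<^bsub>?A\<^esub> \<gamma>) (\<phi> v)" using y(2) \<phi>v by (simp add: conj_hom_def)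
        also have "\<dots> = (\<delta> \<otimes>\<^bsub>?A\<^esub> \<theta> x) (\<gamma> (\<phi> v))"
          using Aut_fusion_mult[OF P _ \<gamma>(1) \<phi>v] A.m_closed[of \<delta> "\<theta> x"] \<delta> \<theta>_mem[OF x] by simp
        also have "\<gamma> (\<phi> v) = \<psi> v" using \<gamma>\<delta>[OF \<psi>v] \<phi>_eq[OF v] by simp
        also have "(\<delta> \<otimes>\<^bsub>?A\<^esub> \<theta> x) (\<psi> v) = \<delta> (\<theta> x (\<psi> v))" using Aut_fusion_mult[OF P \<delta> \<theta>_mem[OF x] \<psi>v] .
        also have "\<dots> = \<phi> (x \<otimes> v \<otimes> inv x)" using \<theta>_eq[OF \<psi>v] \<chi>\<psi>[OF v] \<phi>_eq[OF normal[OF x v]] by simp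
        finally show ?thesis by simp
      qed
      moreover have "y \<in> carrier S" using y(1) mem_normalizer_iff[OF PS] by simp
      ultimately show "x \<in> extender S Q \<phi>" using x unfolding extender_def by blast
    qed
  qed (auto simp: extender_def)
  then obtain \<phi>' where \<phi>': "\<phi>' \<in> F ?N (carrier S)" "\<forall>v\<in>Q. \<phi>' v = \<phi> v"
    using extension_axiom[OF Q \<phi>] \<phi>Q sylow(1) by auto
  have "\<phi>' ` Q = P" using \<phi>'(2) \<phi>Q by (metis image_cong)
  thus thesis using that \<phi>'(1) by blast
qed

text \<open>
  \<open>X\<close> becomes a set over the normalizer \<open>N\<close> of \<open>Q\<close> both by restriction and along a morphism
  \<open>\<phi>: N \<rightarrow> S\<close> with \<open>\<phi>(Q) = P\<close>. The marks of both agree above \<open>Q\<close>, so their difference at \<open>Q\<close> only comes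
  from points with stabilizer exactly \<open>Q\<close>, and there are none of these in the restriction.
\<close>

lemma mark_fully_normalized_congruence:
  assumes P: "subgroup P S" and fn: "fully_normalized S F P"
    and Q: "subgroup Q S" and QP: "fusion_conj F Q P"
    and X: "finite_gset S X" and zero: "exact S X Q = 0"
    and stable: "\<And>R \<phi>. \<lbrakk>subgroup R S; Q \<subset> R; \<phi> \<in> F R (carrier S)\<rbrakk> \<Longrightarrow> mark S X (\<phi> ` R) = mark S X R"
  shows "mark S X Q \<le> mark S X P" "weyl_order S Q dvd mark S X P - mark S X Q"
proof -
  let ?N = "normalizer S Q" and ?H = "S\<lparr>carrier := normalizer S Q\<rparr>"
  have QS: "Q \<subseteq> carrier S" using Q subgroup.subset by auto
  have N: "subgroup ?N S" using QS by (rule normalizer_imp_subgroup)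
  interpret H: group ?H using N by (rule subgroup_imp_group)
  have QN: "Q \<subseteq> ?N" using subset_normalizer[OF Q finite_subgroup[OF Q]] .
  have finN: "finite (carrier ?H)" using finite_subgroup[OF N] by simp
  interpret X: group_action S "fst X" "snd X" using X by (rule finite_gsetD)
  obtain \<phi> where \<phi>: "\<phi> \<in> F ?N (carrier S)" "\<phi> ` Q = P"
    using morphism_to_fully_normalized[OF P fn Q QP] .
  define Y where "Y = (fst X, \<lambda>g. snd X (\<phi> g))"
  have "group_action ?H (fst X) (\<lambda>g. snd X (\<phi> g))"
    using X.pullback[OF H.is_group group_hom.homh[OF morphism_group_hom[OF N subgroup_carrier \<phi>(1)]]] .
  hence Y: "finite_gset ?H Y" using X by (simp add: finite_gset_def Y_def)
  have X': "finite_gset ?H X" using restrict_finite_gset[OF X N] .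
  have \<phi>S: "\<phi> g \<in> carrier S" if "g \<in> ?N" for g using morphism_closed[OF N subgroup_carrier \<phi>(1) that] .
  have markY: "mark ?H Y R = mark S X (\<phi> ` R)" if "R \<subseteq> ?N" for R
  proof -
    have "R \<subseteq> stabilizer ?H (snd Y) x \<longleftrightarrow> \<phi> ` R \<subseteq> stabilizer S (snd X) x" for x
      using that \<phi>S by (auto simp: stabilizer_def Y_def)
    thus ?thesis by (simp add: mark_def Y_def)
  qed
  have markX: "mark ?H X R = mark S X R" if "R \<subseteq> ?N" for R
  proof -
    have "R \<subseteq> stabilizer ?H (snd X) x \<longleftrightarrow> R \<subseteq> stabilizer S (snd X) x" for x
      using that subgroup.subset[OF N] by (auto simp: stabilizer_def)
    thus ?thesis by (simp add: mark_def)
  qed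
  have mark_eq: "mark ?H Y R = mark ?H X R" if R: "subgroup R ?H" "Q \<subset> R" for R
  proof -
    have RN: "R \<subseteq> ?N" using subgroup.subset[OF R(1)] by simp
    have RS: "subgroup R S" using incl_subgroup[OF N R(1)] .
    \<comment> \<open>The marks of \<open>Y\<close> are marks of \<open>X\<close> at images under
      \<open>\<phi>\<close>; above \<open>Q\<close> the stability hypothesis applies to the
      restricted morphism.\<close>
    have "restrict \<phi> R \<in> F R (carrier S)"
      using morphism_restrict[OF N subgroup_carrier RS RN \<phi>(1)] .
    hence "mark S X (restrict \<phi> R ` R) = mark S X R" by (rule stable[OF RS R(2)])
    moreover have "restrict \<phi> R ` R = \<phi> ` R" by (rule image_cong) auto
    ultimately show ?thesis using markY[OF RN] markX[OF RN] by simp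
  qed
  have "exact ?H Y R = exact ?H X R" if R: "subgroup R ?H" "Q \<subset> R" for R
    using mark_eq R(2) by (intro exact_eq_if_mark_eq[OF finN Y X' R(1)]) auto
  hence sum_eq: "(\<Sum>R | subgroup R ?H \<and> Q \<subset> R. exact ?H Y R) = (\<Sum>R | subgroup R ?H \<and> Q \<subset> R. exact ?H X R)"
    by (intro sum.cong) auto
  have QH: "subgroup Q ?H" using normalizer_normal(1)[OF Q] .
  have "mark S X P = exact ?H Y Q + (\<Sum>R | subgroup R ?H \<and> Q \<subset> R. exact ?H X R)"
    using mark_split[OF finN Y QH] markY[OF QN] \<phi>(2) sum_eq by simp
  moreover have "mark S X Q = (\<Sum>R | subgroup R ?H \<and> Q \<subset> R. exact ?H X R)"
    using mark_split[OF finN X' QH] markX[OF QN] exact_normalizer_eq[OF X Q] zero by simp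
  \<comment> \<open>The difference is a number of points, hence nonnegative, and it is the exact
    number at \<open>Q\<close> of a set over the normalizer, hence divisible.\<close>
  ultimately have "mark S X P = exact ?H Y Q + mark S X Q" by simp
  thus "mark S X Q \<le> mark S X P" "weyl_order S Q dvd mark S X P - mark S X Q"
    using weyl_order_dvd_exact_normalizer[OF Y Q] by simp_all
qed

end


section \<open>Stable sets and their coordinates\<close>

context fusion_system
begin

lemma finite_gset_pullback:
  assumes P: "subgroup P S" and \<phi>: "\<phi> \<in> F P (carrier S)" and X: "finite_gset S X"
  shows "finite_gset (S\<lparr>carrier := P\<rparr>) (gset_pullback \<phi> X)"
  using group_action.pullback[OF finite_gsetD(2)[OF X] subgroup_imp_group[OF P]
      group_hom.homh[OF morphism_group_hom[OF P subgroup_carrier \<phi>]]] finite_gsetD(1)[OF X]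
  by (simp add: finite_gset_def gset_pullback_def)

lemma mark_gset_pullback:
  assumes P: "subgroup P S" and \<phi>: "\<phi> \<in> F P (carrier S)" and R: "R \<subseteq> P"
  shows "mark (S\<lparr>carrier := P\<rparr>) (gset_pullback \<phi> X) R = mark S X (\<phi> ` R)"
proof -
  have "R \<subseteq> stabilizer (S\<lparr>carrier := P\<rparr>) (\<lambda>g. snd X (\<phi> g)) x \<longleftrightarrow> \<phi> ` R \<subseteq> stabilizer S (snd X) x" for x
    using R morphism_closed[OF P subgroup_carrier \<phi>] by (auto simp: stabilizer_def)
  thus ?thesis by (simp add: mark_def gset_pullback_def)
qed

text \<open>Over each \<open>P\<close> the two actions are compared by their marks, and the mark of
  the pullback at a subgroup \<open>R\<close> is the mark of \<open>X\<close> at the image of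
  \<open>R\<close>. Restricting the morphism to \<open>R\<close> reduces this to the stated
  equation.\<close>

lemma stable_gset_iff:
  "stable_gset S F X \<longleftrightarrow> finite_gset S X \<and>
     (\<forall>P \<phi>. subgroup P S \<and> \<phi> \<in> F P (carrier S) \<longrightarrow> mark S X (\<phi> ` P) = mark S X P)"
proof (cases "finite_gset S X")
  case X: True
  show ?thesis
  proof
    assume st: "stable_gset S F X"
    have "mark S X (\<phi> ` P) = mark S X P" if P: "subgroup P S" and \<phi>: "\<phi> \<in> F P (carrier S)" for P \<phi>
    proof -
      have i: "(\<lambda>x\<in>P. x) \<in> F P (carrier S)"
        using inclusion_morphism[OF P subgroup_carrier subgroup.subset[OF P]] .
      have "gset_iso (S\<lparr>carrier := P\<rparr>) (gset_pullback \<phi> X) (gset_pullback (\<lambda>x\<in>P. x) X)"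
        using st P \<phi> unfolding stable_gset_def by blast
      from mark_iso[OF finite_gset_pullback[OF P \<phi> X] this, of P] show ?thesis
        using mark_gset_pullback[OF P \<phi> order_refl, of X] mark_gset_pullback[OF P i order_refl, of X] by simp
    qed
    thus "finite_gset S X \<and> (\<forall>P \<phi>. subgroup P S \<and> \<phi> \<in> F P (carrier S) \<longrightarrow> mark S X (\<phi> ` P) = mark S X P)"
      using X by blast
  next
    assume eq: "finite_gset S X \<and>
      (\<forall>P \<phi>. subgroup P S \<and> \<phi> \<in> F P (carrier S) \<longrightarrow> mark S X (\<phi> ` P) = mark S X P)"
    have "gset_iso (S\<lparr>carrier := P\<rparr>) (gset_pullback \<phi> X) (gset_pullback (\<lambda>x\<in>P. x) X)"
      if P: "subgroup P S" and \<phi>: "\<phi> \<in> F P (carrier S)" for P \<phi>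
    proof (rule gset_iso_if_mark_eq)
      have i: "(\<lambda>x\<in>P. x) \<in> F P (carrier S)"
        using inclusion_morphism[OF P subgroup_carrier subgroup.subset[OF P]] .
      show "finite (carrier (S\<lparr>carrier := P\<rparr>))" using finite_subgroup[OF P] by simp
      show "finite_gset (S\<lparr>carrier := P\<rparr>) (gset_pullback \<phi> X)"
        "finite_gset (S\<lparr>carrier := P\<rparr>) (gset_pullback (\<lambda>x\<in>P. x) X)"
        using finite_gset_pullback[OF P _ X] \<phi> i by auto
      fix R assume R: "subgroup R (S\<lparr>carrier := P\<rparr>)"
      have RP: "R \<subseteq> P" using subgroup.subset[OF R] by simp
      have RS: "subgroup R S" using incl_subgroup[OF P R] .
      have "restrict \<phi> R \<in> F R (carrier S)" using morphism_restrict[OF P subgroup_carrier RS RP \<phi>] .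
      hence "mark S X (restrict \<phi> R ` R) = mark S X R" using eq RS by blast
      moreover have "restrict \<phi> R ` R = \<phi> ` R" "(\<lambda>x\<in>P. x) ` R = R" using RP by auto
      ultimately show "mark (S\<lparr>carrier := P\<rparr>) (gset_pullback \<phi> X) R
          = mark (S\<lparr>carrier := P\<rparr>) (gset_pullback (\<lambda>x\<in>P. x) X) R"
        using mark_gset_pullback[OF P \<phi> RP, of X] mark_gset_pullback[OF P i RP, of X] by metis
    qed
    thus "stable_gset S F X" unfolding stable_gset_def using X by blast
  qed
qed (simp add: stable_gset_def)

lemma stable_finite: "stable_gset S F X \<Longrightarrow> finite_gset S X"
  by (simp add: stable_gset_def)

lemma stable_mark_eq:
  "\<lbrakk>stable_gset S F X; subgroup P S; subgroup Q S; fusion_conj F P Q\<rbrakk> \<Longrightarrow> mark S X P = mark S X Q"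
  using fusion_conj_iff stable_gset_iff by metis

lemma stable_iso:
  assumes "stable_gset S F X" "gset_iso S X Y" "finite_gset S Y"
  shows "stable_gset S F Y"
  using assms mark_iso[OF stable_finite[OF assms(1)] assms(2)] unfolding stable_gset_iff by simp

lemma stable_gset_empty: "stable_gset S F gset_empty"
  unfolding stable_gset_iff using finite_gset_empty by (simp add: mark_def gset_empty_def)

lemma stable_gset_sum:
  assumes "stable_gset S F X" "stable_gset S F Y"
  shows "stable_gset S F (gset_sum X Y)"
  using assms finite_gset_sum[of S X Y] mark_gset_sum[of S X Y] unfolding stable_gset_iff by simp

lemma stable_gset_Sum:
  assumes I: "finite I" and Y: "\<And>i. i \<in> I \<Longrightarrow> stable_gset S F (Y i)"
  shows "stable_gset S F (gset_Sum I Y)"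
proof -
  have fin: "finite_gset S (Y i)" if "i \<in> I" for i using Y[OF that] by (rule stable_finite)
  show ?thesis
    unfolding stable_gset_iff
  proof (intro conjI allI impI)
    show "finite_gset S (gset_Sum I Y)" using finite_gset_Sum[OF is_group I fin] .
    fix P \<phi> assume "subgroup P S \<and> \<phi> \<in> F P (carrier S)"
    hence "mark S (Y i) (\<phi> ` P) = mark S (Y i) P" if "i \<in> I" for i
      using Y[OF that] unfolding stable_gset_iff by blast
    hence "(\<Sum>i\<in>I. mark S (Y i) (\<phi> ` P)) = (\<Sum>i\<in>I. mark S (Y i) P)" by (intro sum.cong) auto
    thus "mark S (gset_Sum I Y) (\<phi> ` P) = mark S (gset_Sum I Y) P"
      by (simp add: mark_gset_Sum[OF I fin])
  qed
qed

text \<open>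
  By \<open>weyl_order_dvd_exact\<close> this is the number of orbits of \<open>X\<close> isomorphic to \<open>S/P\<close>, where \<open>P\<close> is the
  chosen fully normalized representative of \<open>C\<close>.
\<close>

definition class_coord :: "('a, 'x) gset \<Rightarrow> 'a set set \<Rightarrow> nat"
  where "class_coord X C = exact S X (class_rep C) div weyl_order S (class_rep C)"

lemma exact_class_rep:
  assumes "finite_gset S X" "C \<in> conj_classes S F"
  shows "exact S X (class_rep C) = class_coord X C * weyl_order S (class_rep C)"
  using weyl_order_dvd_exact[OF assms(1) class_rep(1)[OF assms(2)]] by (simp add: class_coord_def)

lemma class_coord_eqI:
  assumes "C \<in> conj_classes S F" "exact S X (class_rep C) = n * weyl_order S (class_rep C)"
  shows "class_coord X C = n"
  using assms weyl_order_pos[OF class_rep(1)[OF assms(1)]] by (simp add: class_coord_def)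

lemma class_coord_iso:
  "\<lbrakk>finite_gset S X; gset_iso S X Y\<rbrakk> \<Longrightarrow> class_coord X C = class_coord Y C"
  using exact_iso[of S X Y] by (simp add: class_coord_def)

lemma class_coord_gset_sum:
  assumes "finite_gset S X" "finite_gset S Y" "C \<in> conj_classes S F"
  shows "class_coord (gset_sum X Y) C = class_coord X C + class_coord Y C"
  using assms(3) exact_gset_sum[OF assms(1,2)] exact_class_rep[OF assms(1,3)] exact_class_rep[OF assms(2,3)]
  by (intro class_coord_eqI) (simp_all add: distrib_right)

lemma class_coord_gset_Sum:
  assumes "finite I" "\<And>i. i \<in> I \<Longrightarrow> finite_gset S (Y i)" "C \<in> conj_classes S F"
  shows "class_coord (gset_Sum I Y) C = (\<Sum>i\<in>I. class_coord (Y i) C)"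
proof (rule class_coord_eqI[OF assms(3)])
  have "exact S (gset_Sum I Y) (class_rep C) = (\<Sum>i\<in>I. exact S (Y i) (class_rep C))"
    using exact_gset_Sum[OF assms(1,2)] .
  also have "\<dots> = (\<Sum>i\<in>I. class_coord (Y i) C * weyl_order S (class_rep C))"
    using exact_class_rep[OF assms(2,3)] by (rule sum.cong[OF refl])
  finally show "exact S (gset_Sum I Y) (class_rep C) = (\<Sum>i\<in>I. class_coord (Y i) C) * weyl_order S (class_rep C)"
    by (simp add: sum_distrib_right)
qed

lemma class_coord_empty: "fst X = {} \<Longrightarrow> class_coord X C = 0"
  by (simp add: class_coord_def exact_def)

text \<open>From large to small subgroups: the coordinate gives the exact number at the
  representative, adding the part from above gives its mark, stability moves the mark to
  \<open>Q\<close>, and subtracting the part above \<open>Q\<close> gives the exact number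
  there.\<close>

lemma gset_iso_if_class_coord_eq:
  assumes X: "stable_gset S F X" and Y: "stable_gset S F Y"
    and eq: "\<And>C. C \<in> conj_classes S F \<Longrightarrow> class_coord X C = class_coord Y C"
  shows "gset_iso S X Y"
proof (rule gset_iso_if_exact_eq)
  note fX = stable_finite[OF X] and fY = stable_finite[OF Y]
  show "finite_gset S X" "finite_gset S Y" by (fact fX fY)+
  fix Q assume "subgroup Q S"
  thus "exact S X Q = exact S Y Q"
  proof (induction "card (carrier S) - card Q" arbitrary: Q rule: less_induct)
    case less
    \<comment> \<open>Stated for every \<open>P\<close> of the order of \<open>Q\<close>, since it
      serves both for the representative and for \<open>Q\<close> itself.\<close>
    have above: "(\<Sum>R | subgroup R S \<and> P \<subset> R. exact S X R) = (\<Sum>R | subgroup R S \<and> P \<subset> R. exact S Y R)"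
      if P: "card P = card Q" for P
    proof (rule sum.cong[OF refl])
      fix R assume R: "R \<in> {R. subgroup R S \<and> P \<subset> R}"
      have "R \<subseteq> carrier S" using R subgroup.subset by blast
      hence "card R \<le> card (carrier S)" by (rule card_mono[OF finite_carrier])
      moreover have "card P < card R" using R finite_subgroup by (auto intro: psubset_card_mono)
      ultimately have "card (carrier S) - card R < card (carrier S) - card Q" using P by simp
      thus "exact S X R = exact S Y R" using less.hyps R by blast
    qed
    define C where "C = conj_class S F Q"
    have C: "C \<in> conj_classes S F" using less.prems by (auto simp: C_def conj_classes_def)
    let ?P = "class_rep C"
    have P: "subgroup ?P S" and PQ: "fusion_conj F ?P Q"
      using class_rep[OF C] conj_class_eq_iff less.prems by (auto simp: C_def)
    have "exact S X ?P = exact S Y ?P"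
      using exact_class_rep[OF fX C] exact_class_rep[OF fY C] eq[OF C] by simp
    hence "mark S X ?P = mark S Y ?P"
      using mark_split[OF finite_carrier fX P] mark_split[OF finite_carrier fY P]
        above[of ?P] card_fusion_conj[OF P less.prems PQ] by simp
    hence "mark S X Q = mark S Y Q"
      using stable_mark_eq[OF X P less.prems PQ] stable_mark_eq[OF Y P less.prems PQ] by simp
    thus ?case
      using mark_split[OF finite_carrier fX less.prems] mark_split[OF finite_carrier fY less.prems]
        above[of Q] by simp
  qed
qed

end

section \<open>Stable sets with prescribed coordinates\<close>

context saturated_fusion_system
begin

text \<open>All orders are powers of p, \<open>P\<close> and \<open>Q\<close> have the same order,
  and the normalizer of \<open>P\<close> is at least as large. So the points gained at
  \<open>P\<close> from new orbits S/P can be matched at \<open>Q\<close> by whole orbits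
  S/Q.\<close>

lemma weyl_order_dvd_fully_normalized:
  assumes P: "subgroup P S" and fn: "fully_normalized S F P"
    and Q: "subgroup Q S" and PQ: "fusion_conj F P Q"
  shows "weyl_order S Q dvd weyl_order S P"
proof -
  have N: "subgroup (normalizer S P) S" "subgroup (normalizer S Q) S"
    using normalizer_imp_subgroup[OF subgroup.subset] P Q by auto
  obtain k l where k: "card (normalizer S P) = p ^ k" and l: "card (normalizer S Q) = p ^ l"
    using card_subgroup[OF N(1)] card_subgroup[OF N(2)] by metis
  obtain m where m: "card Q = p ^ m" using card_subgroup[OF Q] by metis
  have p1: "p > 1" using prime_gt_1_nat[OF prime_p] .
  have "card (normalizer S Q) \<le> card (normalizer S P)"
    using fn Q PQ by (auto simp: fully_normalized_def conj_class_def)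
  hence "l \<le> k" using k l p1 by (metis power_increasing_iff)
  moreover have "m \<le> l"
    using card_mono[OF finite_subgroup[OF N(2)] subset_normalizer[OF Q finite_subgroup[OF Q]]] m l p1
    by (metis power_increasing_iff)
  ultimately have "p ^ l div p ^ m dvd p ^ k div p ^ m"
    using p1 by (simp add: power_diff[symmetric] le_imp_power_dvd diff_le_mono)
  moreover have "card P = p ^ m" using card_fusion_conj[OF P Q PQ] m by simp
  ultimately show ?thesis using k l m by (simp add: weyl_order_def)
qed

text \<open>
  One step of the construction of a stable set: orbits \<open>S/R\<close> with \<open>card R = n\<close> are added until the mark
  at \<open>R\<close> agrees with the one at the fully normalized representative of its class. The latter does not
  change, since it already is the largest mark in the class.
\<close>

lemma stabilize_step:
  fixes X :: "('a, 'x :: infinite) gset"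
  assumes X: "finite_gset S X"
    and stable: "\<And>R \<phi>. \<lbrakk>subgroup R S; n < card R; \<phi> \<in> F R (carrier S)\<rbrakk> \<Longrightarrow> mark S X (\<phi> ` R) = mark S X R"
    and zero: "\<And>R. \<lbrakk>subgroup R S; card R \<le> n\<rbrakk> \<Longrightarrow> exact S X R = 0"
  obtains Y :: "('a, 'x) gset" where "finite_gset S Y"
    "\<And>R \<phi>. \<lbrakk>subgroup R S; n \<le> card R; \<phi> \<in> F R (carrier S)\<rbrakk> \<Longrightarrow> mark S Y (\<phi> ` R) = mark S Y R"
    "\<And>R. \<lbrakk>subgroup R S; card R < n\<rbrakk> \<Longrightarrow> exact S Y R = 0"
    "\<And>R. \<lbrakk>subgroup R S; n < card R\<rbrakk> \<Longrightarrow> exact S Y R = exact S X R"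
    "\<And>C. \<lbrakk>C \<in> conj_classes S F; card (class_rep C) = n\<rbrakk>
       \<Longrightarrow> exact S Y (class_rep C) = f C * weyl_order S (class_rep C)"
proof -
  let ?c = "conj_class S F" and ?r = "\<lambda>R. class_rep (conj_class S F R)"
  \<comment> \<open>The common mark the class is to reach: the present mark at the representative,
    raised by the \<open>f C\<close> orbits required there.\<close>
  define target where "target C = f C * weyl_order S (class_rep C) + mark S X (class_rep C)" for C
  \<comment> \<open>The exact numbers wanted for \<open>Y\<close>. At order \<open>n\<close> nothing
    has a stabilizer of that order yet, so the whole deficit of the mark is filled by exact points;
    by \<open>key\<close> it is a genuine difference.\<close>
  define e where "e R = (if card R = n then target (?c R) - mark S X R else exact S X R)" for R
  have cls: "?c R \<in> conj_classes S F" if "subgroup R S" for R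
    using that by (auto simp: conj_classes_def)
  have r: "subgroup (?r R) S" "fully_normalized S F (?r R)" "fusion_conj F (?r R) R"
    "card (?r R) = card R" "?c (?r R) = ?c R" if R: "subgroup R S" for R
  proof -
    note C = class_rep[OF cls[OF R]]
    show "subgroup (?r R) S" "fully_normalized S F (?r R)" "?c (?r R) = ?c R" using C by auto
    show "fusion_conj F (?r R) R" using C(2) conj_class_eq_iff[OF C(1) R] by simp
    thus "card (?r R) = card R" using card_fusion_conj[OF C(1) R] by simp
  qed
  have key: "mark S X R \<le> mark S X (?r R)" "weyl_order S R dvd mark S X (?r R) - mark S X R"
    if R: "subgroup R S" "card R = n" for R
  proof -
    have "mark S X (\<phi> ` T) = mark S X T"
      if "subgroup T S" "R \<subset> T" "\<phi> \<in> F T (carrier S)" for T \<phi>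
      using stable[OF that(1) _ that(3)] psubset_card_mono[OF finite_subgroup[OF that(1)] that(2)] R(2)
      by simp
    note * = mark_fully_normalized_congruence[OF r(1,2)[OF R(1)] R(1) fusion_conj_sym[OF r(3)[OF R(1)]] X _ this]
    show "mark S X R \<le> mark S X (?r R)" "weyl_order S R dvd mark S X (?r R) - mark S X R"
      using * zero R by auto
  qed
  have e_conj: "e (conjugate S g R) = e R" if R: "subgroup R S" and g: "g \<in> carrier S" for R g
  proof -
    have RS: "R \<subseteq> carrier S" using R by (rule subgroup.subset)
    have "?c (conjugate S g R) = ?c R"
      using conj_class_eq_iff[OF R conjugate_subgroup[OF R g]] conjugate_fusion_conj[OF R g] by simp
    thus ?thesis
      using card_conjugate[OF RS g] mark_conjugate[OF X g RS] exact_conjugate[OF X g RS]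
      by (simp add: e_def)
  qed
  have e_dvd: "weyl_order S R dvd e R" if R: "subgroup R S" for R
  proof (cases "card R = n")
    case True
    \<comment> \<open>The deficit splits into the points required at the representative and the
      difference of two marks of \<open>X\<close>. The first is divisible by full normalization, the
      second by the congruence.\<close>
    have "weyl_order S R dvd f (?c R) * weyl_order S (?r R)"
      using weyl_order_dvd_fully_normalized[OF r(1,2)[OF R] R r(3)[OF R]] by simp
    moreover have "e R = f (?c R) * weyl_order S (?r R) + (mark S X (?r R) - mark S X R)"
      using True key(1)[OF R True] by (simp add: e_def target_def)
    ultimately show ?thesis using key(2)[OF R True] by simp
  qed (use weyl_order_dvd_exact[OF X R] in \<open>simp add: e_def\<close>)
  obtain Y :: "('a, 'x) gset" where Y: "finite_gset S Y" "\<And>R. subgroup R S \<Longrightarrow> exact S Y R = e R"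
    using exact_realization[of e, OF e_conj e_dvd, where 'x = 'x] by blast
  have sum_eq: "(\<Sum>T | subgroup T S \<and> R \<subset> T. exact S Y T) = (\<Sum>T | subgroup T S \<and> R \<subset> T. exact S X T)"
    if R: "subgroup R S" "n \<le> card R" for R
  proof (rule sum.cong[OF refl])
    fix T assume "T \<in> {T. subgroup T S \<and> R \<subset> T}"
    hence T: "subgroup T S" "R \<subset> T" by auto
    hence "card R < card T" using psubset_card_mono[OF finite_subgroup] by blast
    thus "exact S Y T = exact S X T" using Y(2)[OF T(1)] R(2) by (simp add: e_def)
  qed
  have mark_Y: "mark S Y R = (if card R = n then target (?c R) else mark S X R)"
    if R: "subgroup R S" "n \<le> card R" for R
  proof (cases "card R = n")
    case True
    have "mark S Y R = e R + (\<Sum>T | subgroup T S \<and> R \<subset> T. exact S X T)"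
      using mark_split[OF finite_carrier Y(1) R(1)] sum_eq[OF R] Y(2)[OF R(1)] by simp
    \<comment> \<open>By \<open>zero\<close> all points of \<open>X\<close> counted in this mark
      have strictly larger stabilizers.\<close>
    also have "(\<Sum>T | subgroup T S \<and> R \<subset> T. exact S X T) = mark S X R"
      using mark_split[OF finite_carrier X R(1)] zero[OF R(1)] True by simp
    finally show ?thesis using True key(1)[OF R(1) True] by (simp add: e_def target_def)
  next
    case False
    thus ?thesis
      using mark_split[OF finite_carrier Y(1) R(1)] mark_split[OF finite_carrier X R(1)]
        sum_eq[OF R] Y(2)[OF R(1)] by (simp add: e_def)
  qed
  show thesis
  proof (rule that[OF Y(1)])
    fix R \<phi> assume R: "subgroup R S" "n \<le> card R" and \<phi>: "\<phi> \<in> F R (carrier S)"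
    have Q: "subgroup (\<phi> ` R) S" "card (\<phi> ` R) = card R"
      using morphism_image_subgroup[OF R(1) subgroup_carrier \<phi>] card_morphism_image[OF R(1) subgroup_carrier \<phi>]
      by auto
    have "fusion_conj F R (\<phi> ` R)" using fusion_conj_iff[OF R(1) Q(1)] \<phi> by blast
    hence "?c (\<phi> ` R) = ?c R" using conj_class_eq_iff[OF R(1) Q(1)] by simp
    thus "mark S Y (\<phi> ` R) = mark S Y R"
      using mark_Y[OF R] mark_Y[OF Q(1)] Q(2) R stable[OF R(1) _ \<phi>] by simp
  next
    show "exact S Y R = 0" if "subgroup R S" "card R < n" for R
      using that Y(2) zero by (simp add: e_def)
    show "exact S Y R = exact S X R" if "subgroup R S" "n < card R" for R
      using that Y(2) by (simp add: e_def)
    show "exact S Y (class_rep C) = f C * weyl_order S (class_rep C)"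
      if "C \<in> conj_classes S F" "card (class_rep C) = n" for C
      using class_rep[OF that(1)] that(2) Y(2) by (simp add: e_def target_def)
  qed
qed

text \<open>The orders of subgroups are treated in decreasing order by
  \<open>stabilize_step\<close>, starting with the empty set.\<close>

lemma class_coord_realization:
  "\<exists>X :: ('a, 'x :: infinite) gset. stable_gset S F X \<and> (\<forall>C\<in>conj_classes S F. class_coord X C = f C)"
proof -
  \<comment> \<open>The state once all orders from \<open>n\<close> upwards are treated: marks are
    stable and the prescribed numbers are reached there, and no stabilizer is smaller.\<close>
  let ?P = "\<lambda>n X. finite_gset S X \<and>
     (\<forall>R \<phi>. subgroup R S \<and> n \<le> card R \<and> \<phi> \<in> F R (carrier S) \<longrightarrow> mark S X (\<phi> ` R) = mark S X R) \<and>
     (\<forall>R. subgroup R S \<and> card R < n \<longrightarrow> exact S X R = 0) \<and>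
     (\<forall>C\<in>conj_classes S F. n \<le> card (class_rep C) \<longrightarrow>
        exact S X (class_rep C) = f C * weyl_order S (class_rep C))"
  have card_less: "card R < Suc (card (carrier S))" if "subgroup R S" for R
    using card_mono[OF finite_carrier subgroup.subset[OF that]] by simp
  \<comment> \<open>The threshold starts at |S| + 1, beyond every subgroup order, where the empty
    set qualifies.\<close>
  have "\<exists>X :: ('a, 'x) gset. ?P (Suc (card (carrier S)) - k) X" for k
  proof (induction k)
    case 0
    let ?X = "({}, \<lambda>g. \<lambda>x\<in>{}. x) :: ('a, 'x) gset"
    have "finite_gset S ?X" by (rule finite_gset_empty_carrier) auto
    moreover have "exact S ?X R = 0" for R by (simp add: exact_def)
    moreover have "\<not> Suc (card (carrier S)) \<le> card R" if "subgroup R S" for R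
      using card_less[OF that] by simp
    ultimately show ?case using class_rep(1) by (intro exI[of _ ?X]) auto
  next
    case (Suc k)
    then obtain X :: "('a, 'x) gset" where X: "?P (Suc (card (carrier S)) - k) X" by blast
    show ?case
    proof (cases "k < Suc (card (carrier S))")
      case True
      define n where "n = Suc (card (carrier S)) - Suc k"
      have Sn: "Suc (card (carrier S)) - k = Suc n" using True by (simp add: n_def)
      note X = X[unfolded Sn]
      obtain Y :: "('a, 'x) gset" where Y: "finite_gset S Y"
        "\<And>R \<phi>. \<lbrakk>subgroup R S; n \<le> card R; \<phi> \<in> F R (carrier S)\<rbrakk> \<Longrightarrow> mark S Y (\<phi> ` R) = mark S Y R"
        "\<And>R. \<lbrakk>subgroup R S; card R < n\<rbrakk> \<Longrightarrow> exact S Y R = 0"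
        "\<And>R. \<lbrakk>subgroup R S; n < card R\<rbrakk> \<Longrightarrow> exact S Y R = exact S X R"
        "\<And>C. \<lbrakk>C \<in> conj_classes S F; card (class_rep C) = n\<rbrakk>
           \<Longrightarrow> exact S Y (class_rep C) = f C * weyl_order S (class_rep C)"
        by (rule stabilize_step[of X n f]) (use X in auto)
      have "exact S Y (class_rep C) = f C * weyl_order S (class_rep C)"
        if "C \<in> conj_classes S F" "n \<le> card (class_rep C)" for C
        using Y(4)[OF class_rep(1)[OF that(1)]] Y(5)[OF that(1)] X that
        by (cases "card (class_rep C) = n") auto
      hence "?P n Y" using Y(1-3) by blast
      thus ?thesis unfolding n_def by blast
    next
      \<comment> \<open>The threshold has already reached 0 and truncated subtraction keeps it
        there.\<close>
      case False
      hence "Suc (card (carrier S)) - Suc k = Suc (card (carrier S)) - k" by simp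
      thus ?thesis using Suc by metis
    qed
  qed
  from this[of "Suc (card (carrier S))"] obtain X :: "('a, 'x) gset" where X: "?P 0 X" by auto
  have "stable_gset S F X" using X unfolding stable_gset_iff by simp
  moreover have "class_coord X C = f C" if "C \<in> conj_classes S F" for C
    using X that by (intro class_coord_eqI) auto
  ultimately show ?thesis by blast
qed

end


section \<open>Free commutative monoids from coordinates\<close>

text \<open>Bijections between equally large fibres are glued. It will match two splittings summand
  by summand, labelled by conjugacy classes.\<close>

lemma fibrewise_bij:
  assumes A: "finite A" and B: "finite B"
    and eq: "\<And>c. card {i \<in> A. f i = c} = card {j \<in> B. g j = c}"
  obtains \<pi> where "bij_betw \<pi> A B" "\<And>i. i \<in> A \<Longrightarrow> g (\<pi> i) = f i"
proof -
  have "\<exists>h. bij_betw h {i \<in> A. f i = c} {j \<in> B. g j = c}" for c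
    using A B eq by (intro finite_same_card_bij) auto
  then obtain h where h: "\<And>c. bij_betw (h c) {i \<in> A. f i = c} {j \<in> B. g j = c}" by metis
  define \<pi> where "\<pi> i = h (f i) i" for i
  have img: "\<pi> i \<in> B" "g (\<pi> i) = f i" if "i \<in> A" for i
    using bij_betwE[OF h[of "f i"]] that by (auto simp: \<pi>_def)
  have "inj_on \<pi> A"
  proof (rule inj_onI)
    fix i j assume ij: "i \<in> A" "j \<in> A" "\<pi> i = \<pi> j"
    hence "f i = f j" using img(2) by metis
    thus "i = j" using bij_betw_imp_inj_on[OF h[of "f i"]] ij by (auto simp: \<pi>_def inj_on_def)
  qed
  moreover have "j \<in> \<pi> ` A" if "j \<in> B" for j
  proof -
    have "j \<in> h (g j) ` {i \<in> A. f i = g j}" using h[of "g j"] that by (auto simp: bij_betw_def)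
    then obtain i where i: "i \<in> A" "f i = g j" "j = h (g j) i" by auto
    hence "j = \<pi> i" by (simp add: \<pi>_def)
    thus ?thesis using i(1) by blast
  qed
  ultimately have "bij_betw \<pi> A B" using img(1) by (auto simp: bij_betw_def)
  thus thesis using that img(2) by blast
qed

text \<open>An enumeration of the pairs of an element of \<open>K\<close> and a number below its
  multiplicity, with the second component forgotten.\<close>

lemma indexing_with_multiplicities:
  fixes f :: "'k \<Rightarrow> nat"
  assumes K: "finite K"
  obtains n :: nat and c where "\<And>i. i < n \<Longrightarrow> c i \<in> K" "\<And>k. k \<in> K \<Longrightarrow> card {i \<in> {..<n}. c i = k} = f k"
proof -
  let ?A = "SIGMA k:K. {..<f k}"
  have "finite ?A" using K by auto
  then obtain h where h: "bij_betw h {..<card ?A} ?A"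
    using ex_bij_betw_nat_finite unfolding atLeast0LessThan by blast
  have "card {i \<in> {..<card ?A}. fst (h i) = k} = f k" if k: "k \<in> K" for k
  proof -
    have "h ` {i \<in> {..<card ?A}. fst (h i) = k} = {a \<in> h ` {..<card ?A}. fst a = k}" by auto
    also have "\<dots> = {a \<in> ?A. fst a = k}" using h by (simp add: bij_betw_def)
    also have "\<dots> = {k} \<times> {..<f k}" using k by auto
    finally have "card (h ` {i \<in> {..<card ?A}. fst (h i) = k}) = f k" by simp
    moreover have "inj_on h {i \<in> {..<card ?A}. fst (h i) = k}"
      using bij_betw_imp_inj_on[OF h] by (rule inj_on_subset) auto
    ultimately show ?thesis using card_image[of h "{i \<in> {..<card ?A}. fst (h i) = k}"] by simp
  qed
  moreover have "fst (h i) \<in> K" if "i < card ?A" for i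
  proof -
    have "h i \<in> ?A" using bij_betwE[OF h] that by blast
    thus ?thesis by auto
  qed
  ultimately show thesis using that[of "card ?A" "\<lambda>i. fst (h i)"] by blast
qed

text \<open>The coordinates embed \<open>M\<close> into the functions from \<open>K\<close> to the
  naturals, so the monoid laws are reflected by \<open>inj\<close>. Since the \<open>b k\<close> are
  unit vectors, the exponent of \<open>b k\<close> in a product is the coordinate of the product at
  \<open>k\<close>.\<close>

lemma free_comm_monoid_if_coordinates:
  fixes M :: "('b, 'm) monoid_scheme" (structure) and v :: "'b \<Rightarrow> 'k \<Rightarrow> nat"
  assumes K: "finite K"
    and closed: "\<And>x y. \<lbrakk>x \<in> carrier M; y \<in> carrier M\<rbrakk> \<Longrightarrow> x \<otimes>\<^bsub>M\<^esub> y \<in> carrier M"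
    and one_closed: "\<one>\<^bsub>M\<^esub> \<in> carrier M"
    and mult: "\<And>x y k. \<lbrakk>x \<in> carrier M; y \<in> carrier M; k \<in> K\<rbrakk> \<Longrightarrow> v (x \<otimes>\<^bsub>M\<^esub> y) k = v x k + v y k"
    and one: "\<And>k. k \<in> K \<Longrightarrow> v \<one>\<^bsub>M\<^esub> k = 0"
    and inj: "\<And>x y. \<lbrakk>x \<in> carrier M; y \<in> carrier M; \<And>k. k \<in> K \<Longrightarrow> v x k = v y k\<rbrakk> \<Longrightarrow> x = y"
    and b: "\<And>k. k \<in> K \<Longrightarrow> b k \<in> carrier M"
    and vb: "\<And>k l. \<lbrakk>k \<in> K; l \<in> K\<rbrakk> \<Longrightarrow> v (b k) l = (if k = l then 1 else 0)"
  shows "free_comm_monoid M (b ` K)"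
proof -
  interpret comm_monoid M
    by (rule comm_monoidI) (auto intro!: inj simp: closed one_closed mult one)
  have pow: "v (x [^] (n :: nat)) k = n * v x k" if "x \<in> carrier M" "k \<in> K" for x n k
    using that by (induction n) (simp_all add: mult one)
  have prod: "v (\<Otimes>a\<in>A. f a) k = (\<Sum>a\<in>A. v (f a) k)"
    if "finite A" "f \<in> A \<rightarrow> carrier M" "k \<in> K" for A and f :: "'b \<Rightarrow> 'b" and k
    using that(1,2)
  proof (induction A rule: finite_induct)
    case (insert a A)
    hence "f \<in> A \<rightarrow> carrier M" "f a \<in> carrier M" by auto
    thus ?case using insert that(3) by (simp add: mult finprod_closed)
  qed (simp add: one that(3))
  have b_inj: "inj_on b K"
    using vb by (metis inj_onI zero_neq_one)
  let ?P = "\<lambda>c. finite {a. c a \<noteq> (0::nat)} \<and> {a. c a \<noteq> 0} \<subseteq> b ` K"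
  have closed_prod: "(\<lambda>a. a [^] (c a :: nat)) \<in> {a. c a \<noteq> 0} \<rightarrow> carrier M" if "?P c" for c :: "'b \<Rightarrow> nat"
    using that b by auto
  have v_prod: "v (\<Otimes>a\<in>{a. c a \<noteq> 0}. a [^] c a) k = c (b k)" if c: "?P c" and k: "k \<in> K" for c k
  proof -
    have "v (\<Otimes>a\<in>{a. c a \<noteq> 0}. a [^] c a) k = (\<Sum>a\<in>{a. c a \<noteq> 0}. v (a [^] c a) k)"
      using c by (intro prod closed_prod k) auto
    also have "\<dots> = (\<Sum>a\<in>{a. c a \<noteq> 0}. if a = b k then c a else 0)"
    proof (rule sum.cong[OF refl])
      fix a assume "a \<in> {a. c a \<noteq> 0}"
      then obtain l where l: "l \<in> K" "a = b l" using c by auto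
      hence "a = b k \<longleftrightarrow> l = k" using b_inj k by (auto simp: inj_on_eq_iff)
      thus "v (a [^] c a) k = (if a = b k then c a else 0)"
        using pow[OF b[OF l(1)] k] vb[OF l(1) k] l(2) by simp
    qed
    also have "\<dots> = c (b k)" using c by (simp add: sum.delta)
    finally show ?thesis .
  qed
  have "\<exists>!c. ?P c \<and> x = (\<Otimes>a\<in>{a. c a \<noteq> 0}. a [^] c a)" if x: "x \<in> carrier M" for x
  proof (rule ex_ex1I)
    \<comment> \<open>The exponents have to be the coordinates of \<open>x\<close>, by
      \<open>v_prod\<close>.\<close>
    define c where "c a = (if a \<in> b ` K then v x (inv_into K b a) else 0)" for a
    have "{a. c a \<noteq> 0} \<subseteq> b ` K" by (auto simp: c_def)
    hence c: "?P c" using K finite_subset by blast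
    have "x = (\<Otimes>a\<in>{a. c a \<noteq> 0}. a [^] c a)"
    proof (rule inj[OF x])
      show "(\<Otimes>a\<in>{a. c a \<noteq> 0}. a [^] c a) \<in> carrier M" using closed_prod[OF c] by (rule finprod_closed)
      show "v x k = v (\<Otimes>a\<in>{a. c a \<noteq> 0}. a [^] c a) k" if "k \<in> K" for k
        using v_prod[OF c that] that b_inj by (simp add: c_def)
    qed
    thus "\<exists>c. ?P c \<and> x = (\<Otimes>a\<in>{a. c a \<noteq> 0}. a [^] c a)" using c by blast
  next
    fix c d assume c: "?P c \<and> x = (\<Otimes>a\<in>{a. c a \<noteq> 0}. a [^] c a)"
      and d: "?P d \<and> x = (\<Otimes>a\<in>{a. d a \<noteq> 0}. a [^] d a)"
    have eq: "c (b k) = d (b k)" if "k \<in> K" for k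
      using v_prod[of c k] v_prod[of d k] c d that by metis
    show "c = d"
    proof (rule ext)
      fix a show "c a = d a"
      proof (cases "a \<in> b ` K")
        case False
        hence "c a = 0" "d a = 0" using c d by auto
        thus ?thesis by simp
      qed (use eq in auto)
    qed
  qed
  thus ?thesis unfolding free_comm_monoid_def using comm_monoid_axioms b by (simp add: conj_assoc image_subset_iff)
qed


section \<open>Irreducible stable sets\<close>

text \<open>By transport a class over an infinite type is never empty, so equal classes share a
  member, even if \<open>X\<close> and \<open>Y\<close> live over other types.\<close>

lemma gset_class_eq_iff:
  assumes "finite_gset G X" "finite_gset G Y"
  shows "(gset_class G X :: ('a, 'x :: infinite) gset set) = gset_class G Y \<longleftrightarrow> gset_iso G X Y"
proof
  assume eq: "(gset_class G X :: ('a, 'x) gset set) = gset_class G Y"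
  obtain Z :: "('a, 'x) gset" where Z: "finite_gset G Z" "gset_iso G X Z"
    using gset_transport[OF assms(1)] .
  have "Z \<in> gset_class G Y" using Z eq by (auto simp: gset_class_def)
  hence "gset_iso G Y Z" by (simp add: gset_class_def)
  hence "gset_iso G Z Y" by (rule gset_iso_sym[OF assms(2)])
  thus "gset_iso G X Y" using gset_iso_trans Z by blast
next
  assume XY: "gset_iso G X Y"
  have "gset_iso G X Z \<longleftrightarrow> gset_iso G Y Z" for Z :: "('a, 'x) gset"
    using gset_iso_trans[OF XY, of Z] gset_iso_trans[OF gset_iso_sym[OF assms(1) XY], of Z] by blast
  thus "(gset_class G X :: ('a, 'x) gset set) = gset_class G Y" by (simp only: gset_class_def)
qed

lemma gset_iso_gset_sum:
  assumes X: "finite_gset G X" and X': "finite_gset G X'" and Y: "finite_gset G Y" and Y': "finite_gset G Y'"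
    and "gset_iso G X X'" "gset_iso G Y Y'"
  shows "gset_iso G (gset_sum X Y) (gset_sum X' Y')"
proof (rule gset_iso_if_exact_eq)
  show "finite_gset G (gset_sum X Y)" "finite_gset G (gset_sum X' Y')"
    using finite_gset_sum X X' Y Y' by blast+
  show "exact G (gset_sum X Y) R = exact G (gset_sum X' Y') R" for R
    unfolding exact_gset_sum[OF X Y] exact_gset_sum[OF X' Y']
    using exact_iso[OF X assms(5)] exact_iso[OF Y assms(6)] by (rule arg_cong2)
qed

text \<open>The union that defines addition in \<open>A_plus\<close> consists of copies of one
  class, because sums respect isomorphism.\<close>

lemma gset_class_add:
  fixes X Y :: "('a, 'x :: infinite) gset"
  assumes X: "finite_gset G X" and Y: "finite_gset G Y"
  shows "(\<Union>X'\<in>gset_class G X. \<Union>Y'\<in>gset_class G Y. gset_class G (gset_sum (X' :: ('a, 'x) gset) (Y' :: ('a, 'x) gset)))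
           = (gset_class G (gset_sum X Y) :: ('a, 'x) gset set)" (is "?L = ?R")
proof -
  have "(gset_class G (gset_sum X' Y') :: ('a, 'x) gset set) = ?R"
    if "X' \<in> gset_class G X" "Y' \<in> gset_class G Y" for X' Y' :: "('a, 'x) gset"
  proof -
    have *: "finite_gset G X'" "gset_iso G X X'" "finite_gset G Y'" "gset_iso G Y Y'"
      using that by (auto simp: gset_class_def)
    have "gset_iso G (gset_sum X' Y') (gset_sum X Y)"
      using * X Y gset_iso_sym[OF X *(2)] gset_iso_sym[OF Y *(4)] by (intro gset_iso_gset_sum)
    thus ?thesis using gset_class_eq_iff[OF finite_gset_sum finite_gset_sum] * X Y by blast
  qed
  moreover have "X \<in> gset_class G X" "Y \<in> gset_class G Y"
    unfolding gset_class_def using X Y gset_iso_refl by blast+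
  ultimately show ?thesis by blast
qed

section \<open>Irreducible sets as unit vectors, splittings, and the free monoid\<close>

context saturated_fusion_system
begin

text \<open>The unit vector at \<open>C\<close>; if \<open>C\<close> is not a conjugacy class, all
  coordinates are 0 and the set is empty.\<close>

definition irreducible_of_class :: "'a set set \<Rightarrow> ('a, 'x :: infinite) gset"
  where "irreducible_of_class C =
           (SOME X. stable_gset S F X \<and> (\<forall>D\<in>conj_classes S F. class_coord X D = (if C = D then 1 else 0)))"

lemma irreducible_of_class:
  fixes C defines "X \<equiv> irreducible_of_class C :: ('a, 'x :: infinite) gset"
  shows "stable_gset S F X"
    and "D \<in> conj_classes S F \<Longrightarrow> class_coord X D = (if C = D then 1 else 0)"
proof -
  have "stable_gset S F X \<and> (\<forall>D\<in>conj_classes S F. class_coord X D = (if C = D then 1 else 0))"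
    unfolding X_def irreducible_of_class_def
    by (rule someI_ex) (rule class_coord_realization)
  thus "stable_gset S F X" "D \<in> conj_classes S F \<Longrightarrow> class_coord X D = (if C = D then 1 else 0)" by auto
qed

lemma stable_empty_iff:
  fixes X :: "('a, 'x) gset"
  assumes X: "stable_gset S F X"
  shows "fst X = {} \<longleftrightarrow> (\<forall>C\<in>conj_classes S F. class_coord X C = 0)"
proof
  assume *: "\<forall>C\<in>conj_classes S F. class_coord X C = 0"
  have zero: "class_coord gset_empty C = 0" for C
    by (rule class_coord_empty) (simp add: gset_empty_def)
  have "gset_iso S X gset_empty"
    by (rule gset_iso_if_class_coord_eq[OF X stable_gset_empty]) (simp add: * zero)
  thus "fst X = {}" by (auto simp: gset_iso_def gset_empty_def bij_betw_def)
qed (simp add: class_coord_empty)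

text \<open>A nonzero coordinate at \<open>C\<close> allows the unit vector at \<open>C\<close> to
  be split off, and irreducibility forces the remainder to be empty. Conversely a unit vector is no
  sum of two nonzero vectors.\<close>

lemma irreducible_iff:
  fixes X :: "('a, 'x :: infinite) gset"
  shows "irreducible_gset S F X \<longleftrightarrow> stable_gset S F X \<and>
    (\<exists>C\<in>conj_classes S F. \<forall>D\<in>conj_classes S F. class_coord X D = (if C = D then 1 else 0))"
proof
  assume irr: "irreducible_gset S F X"
  hence X: "stable_gset S F X" and "fst X \<noteq> {}" by (auto simp: irreducible_gset_def)
  then obtain C where C: "C \<in> conj_classes S F" "class_coord X C \<noteq> 0" using stable_empty_iff by blast
  let ?Y = "irreducible_of_class C :: ('a, 'x) gset"
  note Y = irreducible_of_class[where C = C and 'x = 'x]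
  obtain Z :: "('a, 'x) gset" where Z: "stable_gset S F Z"
    "\<And>D. D \<in> conj_classes S F \<Longrightarrow> class_coord Z D = class_coord X D - (if C = D then 1 else 0)"
    \<comment> \<open>The remainder must live over the type of \<open>X\<close>, as in
      \<open>irreducible_gset\<close>; the subtraction is genuine since the coordinate at
      \<open>C\<close> is nonzero.\<close>
    using class_coord_realization[of "\<lambda>D. class_coord X D - (if C = D then 1 else 0)", where 'x = 'x] by blast
  have "gset_iso S X (gset_sum ?Y Z)"
  proof (rule gset_iso_if_class_coord_eq[OF X stable_gset_sum[OF Y(1) Z(1)]])
    fix D assume D: "D \<in> conj_classes S F"
    show "class_coord X D = class_coord (gset_sum ?Y Z) D"
      using class_coord_gset_sum[OF stable_finite[OF Y(1)] stable_finite[OF Z(1)] D] Y(2)[OF D] Z(2)[OF D] C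
      by auto
  qed
  moreover have "fst ?Y \<noteq> {}" using stable_empty_iff[OF Y(1)] Y(2)[OF C(1)] C(1) by auto
  ultimately have "fst Z = {}" using irr Y(1) Z(1) unfolding irreducible_gset_def by blast
  have "class_coord X D = (if C = D then 1 else 0)" if D: "D \<in> conj_classes S F" for D
  proof -
    have "class_coord Z D = 0" using \<open>fst Z = {}\<close> by (rule class_coord_empty)
    thus ?thesis using Z(2)[OF D] C(2) by (auto split: if_splits)
  qed
  thus "stable_gset S F X \<and>
    (\<exists>C\<in>conj_classes S F. \<forall>D\<in>conj_classes S F. class_coord X D = (if C = D then 1 else 0))"
    using X C(1) by blast
next
  assume "stable_gset S F X \<and>
    (\<exists>C\<in>conj_classes S F. \<forall>D\<in>conj_classes S F. class_coord X D = (if C = D then 1 else 0))"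
  then obtain C where X: "stable_gset S F X" and C: "C \<in> conj_classes S F"
    "\<And>D. D \<in> conj_classes S F \<Longrightarrow> class_coord X D = (if C = D then 1 else 0)" by blast
  have "fst X \<noteq> {}" using stable_empty_iff[OF X] C by auto
  moreover have False
    if Y: "stable_gset S F Y" "fst Y \<noteq> {}" and Z: "stable_gset S F Z" "fst Z \<noteq> {}"
      and iso: "gset_iso S X (gset_sum Y Z)" for Y Z :: "('a, 'x) gset"
  proof -
    have add: "class_coord Y D + class_coord Z D = (if C = D then 1 else 0)" if D: "D \<in> conj_classes S F" for D
      using class_coord_iso[OF stable_finite[OF X] iso, of D] C(2)[OF D]
        class_coord_gset_sum[OF stable_finite[OF Y(1)] stable_finite[OF Z(1)] D] by simp
    obtain D where D: "D \<in> conj_classes S F" "class_coord Y D \<noteq> 0" using stable_empty_iff[OF Y(1)] Y(2) by blast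
    obtain E where E: "E \<in> conj_classes S F" "class_coord Z E \<noteq> 0" using stable_empty_iff[OF Z(1)] Z(2) by blast
    have "D = C" using add[OF D(1)] D(2) by (auto split: if_splits)
    moreover have "E = C" using add[OF E(1)] E(2) by (auto split: if_splits)
    ultimately show False using add[OF C(1)] D(2) E(2) by auto
  qed
  ultimately show "irreducible_gset S F X" unfolding irreducible_gset_def using X by blast
qed

lemma irreducible_irreducible_of_class:
  "C \<in> conj_classes S F \<Longrightarrow> irreducible_gset S F (irreducible_of_class C)"
  using irreducible_iff irreducible_of_class by blast

lemma class_coord_split:
  fixes n :: nat
  assumes Y: "\<And>i. i < n \<Longrightarrow> stable_gset S F (Y i)"
    and c: "\<And>i D. \<lbrakk>i < n; D \<in> conj_classes S F\<rbrakk> \<Longrightarrow> class_coord (Y i) D = (if c i = D then 1 else 0)"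
    and D: "D \<in> conj_classes S F"
  shows "class_coord (gset_Sum {..<n} Y) D = card {i \<in> {..<n}. c i = D}"
proof -
  have "finite_gset S (Y i)" if "i \<in> {..<n}" for i
    by (rule stable_finite) (use Y that in simp)
  hence "class_coord (gset_Sum {..<n} Y) D = (\<Sum>i<n. class_coord (Y i) D)"
    by (rule class_coord_gset_Sum[OF finite_lessThan _ D])
  also have "\<dots> = (\<Sum>i<n. if c i = D then 1 else 0)" using c D by (intro sum.cong) auto
  also have "\<dots> = card {i \<in> {..<n}. c i = D}" by (rule card_as_sums[symmetric, OF refl finite_lessThan])
  finally show ?thesis .
qed

text \<open>The irreducible set of each class is repeated as often as the coordinate of
  \<open>X\<close> says.\<close>

lemma splits_exist:
  fixes X :: "('a, 'x :: infinite) gset"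
  assumes X: "stable_gset S F X"
  shows "\<exists>n Y. splits_as S F X n Y"
proof -
  obtain n :: nat and c where c: "\<And>i. i < n \<Longrightarrow> c i \<in> conj_classes S F"
    "\<And>D. D \<in> conj_classes S F \<Longrightarrow> card {i \<in> {..<n}. c i = D} = class_coord X D"
    by (rule indexing_with_multiplicities[OF finite_conj_classes, of "class_coord X"]) blast
  let ?Y = "\<lambda>i. irreducible_of_class (c i) :: ('a, 'x) gset"
  have "gset_iso S X (gset_Sum {..<n} ?Y)"
  proof (rule gset_iso_if_class_coord_eq[OF X])
    show "stable_gset S F (gset_Sum {..<n} ?Y)"
      using irreducible_of_class(1) by (intro stable_gset_Sum) auto
    show "class_coord X D = class_coord (gset_Sum {..<n} ?Y) D" if D: "D \<in> conj_classes S F" for D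
      using class_coord_split[of n ?Y c D, OF irreducible_of_class D] c(2)[OF D] by simp
  qed
  moreover have "\<forall>i<n. irreducible_gset S F (?Y i)"
    by (intro allI impI irreducible_irreducible_of_class c(1))
  ultimately have "splits_as S F X n ?Y" by (simp only: splits_as_def)
  thus ?thesis by blast
qed

text \<open>In any splitting the number of summands with unit vector at \<open>C\<close> is the
  coordinate of \<open>X\<close> at \<open>C\<close>, so two splittings contain each type equally
  often.\<close>

lemma splits_unique:
  fixes X :: "('a, 'x :: infinite) gset"
  assumes X: "stable_gset S F X" and Y: "splits_as S F X n Y" and Z: "splits_as S F X m Z"
  shows "\<exists>\<pi>. bij_betw \<pi> {..<n} {..<m} \<and> (\<forall>i<n. gset_iso S (Y i) (Z (\<pi> i)))"
proof -
  have types: "\<exists>c. (\<forall>i<n. stable_gset S F (Y i) \<and> c i \<in> conj_classes S F \<and>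
      (\<forall>D\<in>conj_classes S F. class_coord (Y i) D = (if c i = D then 1 else 0))) \<and>
      (\<forall>D\<in>conj_classes S F. card {i \<in> {..<n}. c i = D} = class_coord X D)"
    if Y: "splits_as S F X n Y" for n and Y :: "nat \<Rightarrow> ('a, 'x) gset"
  proof -
    have "\<forall>i. \<exists>C. i < n \<longrightarrow> stable_gset S F (Y i) \<and> C \<in> conj_classes S F \<and>
        (\<forall>D\<in>conj_classes S F. class_coord (Y i) D = (if C = D then 1 else 0))"
      using Y irreducible_iff unfolding splits_as_def by blast
    then obtain c where c: "\<forall>i<n. stable_gset S F (Y i) \<and> c i \<in> conj_classes S F \<and>
        (\<forall>D\<in>conj_classes S F. class_coord (Y i) D = (if c i = D then 1 else 0))" by metis
    have "card {i \<in> {..<n}. c i = D} = class_coord X D" if D: "D \<in> conj_classes S F" for D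
    proof -
      have "gset_iso S X (gset_Sum {..<n} Y)" using Y by (simp add: splits_as_def)
      from class_coord_iso[OF stable_finite[OF X] this, of D]
      show ?thesis using class_coord_split[of n Y c D] c D by simp
    qed
    thus ?thesis using c by blast
  qed
  obtain c where c: "\<And>i. i < n \<Longrightarrow> stable_gset S F (Y i)" "\<And>i. i < n \<Longrightarrow> c i \<in> conj_classes S F"
    "\<And>i D. \<lbrakk>i < n; D \<in> conj_classes S F\<rbrakk> \<Longrightarrow> class_coord (Y i) D = (if c i = D then 1 else 0)"
    "\<And>D. D \<in> conj_classes S F \<Longrightarrow> card {i \<in> {..<n}. c i = D} = class_coord X D"
    using types[OF Y] by blast
  obtain d where d: "\<And>i. i < m \<Longrightarrow> stable_gset S F (Z i)" "\<And>i. i < m \<Longrightarrow> d i \<in> conj_classes S F"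
    "\<And>i D. \<lbrakk>i < m; D \<in> conj_classes S F\<rbrakk> \<Longrightarrow> class_coord (Z i) D = (if d i = D then 1 else 0)"
    "\<And>D. D \<in> conj_classes S F \<Longrightarrow> card {i \<in> {..<m}. d i = D} = class_coord X D"
    using types[OF Z] by blast
  have "card {i \<in> {..<n}. c i = D} = card {j \<in> {..<m}. d j = D}" for D
  proof (cases "D \<in> conj_classes S F")
    case False
    hence "{i \<in> {..<n}. c i = D} = {}" "{j \<in> {..<m}. d j = D} = {}" using c(2) d(2) by auto
    thus ?thesis by (simp only:)
  next
    case True
    show ?thesis unfolding c(4)[OF True] d(4)[OF True] ..
  qed
  then obtain \<pi> where \<pi>: "bij_betw \<pi> {..<n} {..<m}" "\<And>i. i \<in> {..<n} \<Longrightarrow> d (\<pi> i) = c i"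
    by (rule fibrewise_bij[OF finite_lessThan finite_lessThan]) blast
  have "gset_iso S (Y i) (Z (\<pi> i))" if i: "i < n" for i
  proof -
    have j: "\<pi> i < m" using bij_betwE[OF \<pi>(1)] i by auto
    show ?thesis
      using c(3)[OF i] d(3)[OF j] \<pi>(2) i
      by (intro gset_iso_if_class_coord_eq c(1)[OF i] d(1)[OF j]) simp
  qed
  thus ?thesis using \<pi>(1) by blast
qed

lemma bij_irreducible_classes:
  "bij_betw (\<lambda>C. gset_class S (irreducible_of_class C :: ('a, 'x) gset))
     (conj_classes S F) (irreducible_classes S F :: ('a, 'x :: infinite) gset set set)"
proof -
  let ?\<alpha> = "irreducible_of_class :: 'a set set \<Rightarrow> ('a, 'x) gset"
  let ?h = "\<lambda>C. gset_class S (?\<alpha> C) :: ('a, 'x) gset set"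
  note \<alpha> = irreducible_of_class[where 'x = 'x]
  have fin: "finite_gset S (?\<alpha> C)" for C using stable_finite[OF \<alpha>(1)] .
  have "inj_on ?h (conj_classes S F)"
  proof (rule inj_onI)
    fix C D assume C: "C \<in> conj_classes S F" and "D \<in> conj_classes S F" and "?h C = ?h D"
    hence "gset_iso S (?\<alpha> C) (?\<alpha> D)" using gset_class_eq_iff[OF fin fin] by blast
    from class_coord_iso[OF fin this, of C] show "C = D" using \<alpha>(2)[OF C] by (simp split: if_splits)
  qed
  moreover have "?h ` conj_classes S F = irreducible_classes S F"
  proof
    show "?h ` conj_classes S F \<subseteq> irreducible_classes S F"
      unfolding irreducible_classes_def using irreducible_irreducible_of_class by blast
    show "irreducible_classes S F \<subseteq> ?h ` conj_classes S F"
    proof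
      fix A assume "A \<in> (irreducible_classes S F :: ('a, 'x) gset set set)"
      then obtain X :: "('a, 'x) gset" where X: "irreducible_gset S F X" "A = gset_class S X"
        by (auto simp: irreducible_classes_def)
      then obtain C where C: "C \<in> conj_classes S F" and st: "stable_gset S F X"
        and "\<forall>D\<in>conj_classes S F. class_coord X D = (if C = D then 1 else 0)"
        using irreducible_iff by blast
      hence "gset_iso S X (?\<alpha> C)" using \<alpha>(2) by (intro gset_iso_if_class_coord_eq[OF st \<alpha>(1)]) simp
      hence "A = ?h C" using X(2) gset_class_eq_iff[OF stable_finite[OF st] fin] by blast
      thus "A \<in> ?h ` conj_classes S F" using C by blast
    qed
  qed
  ultimately show ?thesis unfolding bij_betw_def ..
qed

lemma free_A_plus_stable:
  "free_comm_monoid (add_monoid (A_plus_stable S F :: ('a, 'x :: infinite) gset set ring)) (irreducible_classes S F)"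
proof -
  let ?M = "add_monoid (A_plus_stable S F :: ('a, 'x) gset set ring)"
  let ?cl = "gset_class S :: ('a, 'x) gset \<Rightarrow> ('a, 'x) gset set"
  let ?\<alpha> = "irreducible_of_class :: 'a set set \<Rightarrow> ('a, 'x) gset"
  note \<alpha> = irreducible_of_class[where 'x = 'x]
  \<comment> \<open>Any member of the class will do, since isomorphic sets have equal
    coordinates.\<close>
  define v where "v A = class_coord (SOME X. X \<in> A)" for A :: "('a, 'x) gset set"
  have carrier: "carrier ?M = ?cl ` {X. stable_gset S F X}"
    by (simp add: A_plus_stable_def)
  have mult: "?cl X \<otimes>\<^bsub>?M\<^esub> ?cl Y = gset_class S (gset_sum X Y)"
    if "finite_gset S X" "finite_gset S Y" for X Y :: "('a, 'x) gset"
    using gset_class_add[OF that] by (simp add: A_plus_stable_def A_plus_def)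
  have one: "\<one>\<^bsub>?M\<^esub> = gset_class S gset_empty"
    by (simp add: A_plus_stable_def A_plus_def)
  \<comment> \<open>Over an arbitrary type \<open>'y\<close>, because it is applied to sums and to
    \<open>gset_empty\<close>; the same holds for \<open>class_mem\<close>.\<close>
  have v: "v (gset_class S X) = class_coord X" if X: "finite_gset S X" for X :: "('a, 'y) gset"
  proof -
    obtain Z :: "('a, 'x) gset" where "finite_gset S Z" "gset_iso S X Z"
      using gset_transport[OF X] .
    hence "Z \<in> gset_class S X" by (simp add: gset_class_def)
    hence "\<exists>Z :: ('a, 'x) gset. Z \<in> gset_class S X" by blast
    hence "(SOME Z :: ('a, 'x) gset. Z \<in> gset_class S X) \<in> gset_class S X" by (rule someI_ex)
    hence "gset_iso S X (SOME Z :: ('a, 'x) gset. Z \<in> gset_class S X)" by (simp add: gset_class_def)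
    hence "class_coord X = class_coord (SOME Z :: ('a, 'x) gset. Z \<in> gset_class S X)"
      by (intro ext class_coord_iso[OF X])
    thus ?thesis by (simp only: v_def)
  qed
  have class_mem: "gset_class S X \<in> carrier ?M" if X: "stable_gset S F X" for X :: "('a, 'y) gset"
  proof -
    obtain Z :: "('a, 'x) gset" where Z: "finite_gset S Z" "gset_iso S X Z"
      using gset_transport[OF stable_finite[OF X]] .
    have "?cl Z = gset_class S X" using gset_class_eq_iff[OF stable_finite[OF X] Z(1)] Z(2) by blast
    thus ?thesis unfolding carrier using stable_iso[OF X Z(2,1)] by blast
  qed
  have "free_comm_monoid ?M ((\<lambda>C. ?cl (?\<alpha> C)) ` conj_classes S F)"
  proof (rule free_comm_monoid_if_coordinates[where v = v])
    fix A B assume "A \<in> carrier ?M" "B \<in> carrier ?M"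
    then obtain X Y where X: "stable_gset S F X" "A = ?cl X" and Y: "stable_gset S F Y" "B = ?cl Y"
      unfolding carrier by blast
    note fin = stable_finite[OF X(1)] stable_finite[OF Y(1)]
    have AB: "A \<otimes>\<^bsub>?M\<^esub> B = gset_class S (gset_sum X Y)" using mult fin X(2) Y(2) by simp
    show "A \<otimes>\<^bsub>?M\<^esub> B \<in> carrier ?M" unfolding AB using class_mem[OF stable_gset_sum[OF X(1) Y(1)]] .
    show "v (A \<otimes>\<^bsub>?M\<^esub> B) C = v A C + v B C" if "C \<in> conj_classes S F" for C
      unfolding AB using v[OF finite_gset_sum[OF fin]] v[OF fin(1)] v[OF fin(2)] X(2) Y(2)
        class_coord_gset_sum[OF fin that] by simp
    show "A = B" if "\<And>C. C \<in> conj_classes S F \<Longrightarrow> v A C = v B C"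
    proof -
      have "gset_iso S X Y"
        using that v[OF fin(1)] v[OF fin(2)] X(2) Y(2)
        by (intro gset_iso_if_class_coord_eq[OF X(1) Y(1)]) simp
      thus ?thesis using gset_class_eq_iff[OF fin] X(2) Y(2) by blast
    qed
  next
    show "\<one>\<^bsub>?M\<^esub> \<in> carrier ?M" unfolding one by (rule class_mem[OF stable_gset_empty])
    show "v \<one>\<^bsub>?M\<^esub> C = 0" if "C \<in> conj_classes S F" for C
      unfolding one v[OF finite_gset_empty] by (rule class_coord_empty) (simp add: gset_empty_def)
  next
    show "?cl (?\<alpha> C) \<in> carrier ?M" for C using class_mem[OF \<alpha>(1)] .
    show "v (?cl (?\<alpha> C)) D = (if C = D then 1 else 0)" if "D \<in> conj_classes S F" for C D
      using v[OF stable_finite[OF \<alpha>(1)[of C]]] \<alpha>(2)[OF that] by simp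
  qed (rule finite_conj_classes)
  thus ?thesis using bij_irreducible_classes[where 'x = 'x] by (simp add: bij_betw_def)
qed

end

theorem theorem1:
  fixes S :: "('a, 'm) monoid_scheme" and p :: nat and F :: "'a homsets"
  assumes "saturated_fusion_system S p F"
  shows "(\<forall>X :: ('a, 'x :: infinite) gset. stable_gset S F X \<longrightarrow>
            (\<exists>n Y. splits_as S F X n Y) \<and>
            (\<forall>n Y m Z. splits_as S F X n Y \<and> splits_as S F X m Z \<longrightarrow>
               (\<exists>\<pi>. bij_betw \<pi> {..<n} {..<m} \<and> (\<forall>i<n. gset_iso S (Y i) (Z (\<pi> i)))))) \<and>
         (\<exists>f. bij_betw f (irreducible_classes S F :: ('a, 'x) gset set set) (conj_classes S F)) \<and>
         (\<exists>B. free_comm_monoid (add_monoid (A_plus_stable S F :: ('a, 'x) gset set ring)) B \<and>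
            finite B \<and> card B = card (conj_classes S F))"
proof -
  interpret saturated_fusion_system S p F by fact
  note bij = bij_irreducible_classes[where 'x = 'x]
  have "finite (irreducible_classes S F :: ('a, 'x) gset set set)"
    using bij_betw_finite[OF bij] finite_conj_classes by simp
  moreover have "card (irreducible_classes S F :: ('a, 'x) gset set set) = card (conj_classes S F)"
    using bij_betw_same_card[OF bij] by simp
  ultimately show ?thesis
    using splits_exist splits_unique bij_betw_inv_into[OF bij] free_A_plus_stable[where 'x = 'x] by blast
qed

end
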